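(* Let $G=(V,E,e)$ be a finite connected rooted graph with at least two vertices, and let $\sigma$ be the degree of $e$ in $G$. For $N\geq1$ and $k\geq1$ let $A^{[*N,k]}$ be the adjacency matrix of the distance-$k$ graph of the $N$-fold free power $G^{*N}$. Then, for fixed $k$, the distribution of $(N\sigma)^{-k/2}A^{[*N,k]}$ with respect to the vacuum state converges in moments (and hence weakly) as $N\to\infty$ to the distribution of $P_k(s)$, where $s$ is a random variable with the semicircle law; that is, for every $m\geq1$, $\big((N\sigma)^{-km/2}(A^{[*N,k]})^m\big)_{ee}\to\mathbb{E}[P_k(s)^m]$.
   Context: Free power: let $V^0=V\setminus\{e\}$. The vertex set of $G^{*N}$ consists of the empty word (the root, also denoted $e$) and all finite words $(v_1,i_1)(v_2,i_2)\cdots(v_m,i_m)$, $m\geq1$, with $v_r\in V^0$, $i_r\in\{1,\dots,N\}$ and $i_r\neq i_{r+1}$. For $i\in\{1,\dots,N\}$, a word $u$ whose first letter (if any) does not have index $i$, and $w\in V$, write $w\cdot_i u$ for the word $(w,i)u$ if $w\in V^0$ and for $u$ if $w=e$. Two vertices $x,y$ are adjacent iff $x=v\cdot_i u$, $y=v'\cdot_i u$ for some such $i,u$ and some edge $\{v,v'\}\in E$. The distance-$k$ graph of a graph has the same vertices, with $x,y$ adjacent iff their graph distance is exactly $k$. The vacuum state is $M\mapsto M_{ee}$ (the root entry), and the distribution of a symmetric matrix $M$ with respect to it is the probability measure with moments $(M^m)_{ee}$. $P_k$ is the Chebyshev polynomial defined by $P_0=1$, $P_1(x)=x$, $xP_n(x)=P_{n+1}(x)+P_{n-1}(x)$;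 the semicircle law has density $\frac{1}{2\pi}\sqrt{4-x^2}$ on $[-2,2]$. *)

theory Defs
  imports
    "HOL-Probability.Probability"
    "HOL-Computational_Algebra.Polynomial"
    "HOL-Library.Extended_Nat"
begin

definition simple_graph :: "'a set \<Rightarrow> 'a set set \<Rightarrow> bool" where
  "simple_graph V E \<longleftrightarrow> (\<forall>\<epsilon>\<in>E. \<exists>u v. u \<in> V \<and> v \<in> V \<and> u \<noteq> v \<and> \<epsilon> = {u, v})"

definition adjacent :: "'a set set \<Rightarrow> 'a \<Rightarrow> 'a \<Rightarrow> bool" where
  "adjacent E u v \<longleftrightarrow> {u, v} \<in> E"

definition connected_graph :: "'a set \<Rightarrow> 'a set set \<Rightarrow> bool" where
  "connected_graph V E \<longleftrightarrow> (\<forall>u\<in>V. \<forall>v\<in>V. (adjacent E)\<^sup>*\<^sup>* u v)"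

definition degree_in :: "'a set set \<Rightarrow> 'a \<Rightarrow> nat" where
  "degree_in E v = card {u. adjacent E v u}"

text \<open>The relational power \<open>(adjacent E ^^ n) u v\<close> says that there is a walk with \<open>n\<close> edges from
  \<open>u\<close> to \<open>v\<close>.  The distance is \<open>\<infinity>\<close> when there is no walk at all.\<close>

definition graph_dist :: "'a set set \<Rightarrow> 'a \<Rightarrow> 'a \<Rightarrow> enat" where
  "graph_dist E u v = Inf {enat n | n. (adjacent E ^^ n) u v}"

definition distance_edges :: "'a set \<Rightarrow> 'a set set \<Rightarrow> nat \<Rightarrow> 'a set set" where
  "distance_edges V E k = {{x, y} | x y. x \<in> V \<and> y \<in> V \<and> graph_dist E x y = enat k}"

text \<open>A word \<open>(v\<^sub>1,i\<^sub>1)\<dots>(v\<^sub>m,i\<^sub>m)\<close> is a list of pairs, leftmost letter first; the root of the free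
  power is the empty list.\<close>

definition free_power_verts :: "'a set \<Rightarrow> 'a \<Rightarrow> nat \<Rightarrow> ('a \<times> nat) list set" where
  "free_power_verts V e N =
     {w. set w \<subseteq> (V - {e}) \<times> {1..N} \<and> successively (\<lambda>p q. snd p \<noteq> snd q) w}"

definition attach :: "'a \<Rightarrow> nat \<Rightarrow> 'a \<Rightarrow> ('a \<times> nat) list \<Rightarrow> ('a \<times> nat) list" where
  "attach e i w u = (if w = e then u else (w, i) # u)"

definition free_power_edges ::
    "'a set \<Rightarrow> 'a set set \<Rightarrow> 'a \<Rightarrow> nat \<Rightarrow> ('a \<times> nat) list set set" where
  "free_power_edges V E e N =
     {{attach e i v u, attach e i v' u} | i u v v'.
        i \<in> {1..N} \<and> u \<in> free_power_verts V e N \<and> (u \<noteq> [] \<longrightarrow> snd (hd u) \<noteq> i) \<and> {v, v'} \<in> E}"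

text \<open>Matrices with rows and columns indexed by a possibly infinite set \<open>V\<close>.  In the applications
  every row has only finitely many nonzero entries, so the sum in the product is a finite one.\<close>

definition adjacency_matrix :: "'a set \<Rightarrow> 'a set set \<Rightarrow> 'a \<Rightarrow> 'a \<Rightarrow> real" where
  "adjacency_matrix V E x y = (if x \<in> V \<and> y \<in> V \<and> {x, y} \<in> E then 1 else 0)"

definition matrix_times ::
    "'a set \<Rightarrow> ('a \<Rightarrow> 'a \<Rightarrow> real) \<Rightarrow> ('a \<Rightarrow> 'a \<Rightarrow> real) \<Rightarrow> 'a \<Rightarrow> 'a \<Rightarrow> real" where
  "matrix_times V A B x y = (\<Sum>\<^sub>\<infinity>z\<in>V. A x z * B z y)"

primrec matrix_power :: "'a set \<Rightarrow> ('a \<Rightarrow> 'a \<Rightarrow> real) \<Rightarrow> nat \<Rightarrow> 'a \<Rightarrow> 'a \<Rightarrow> real" where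
  "matrix_power V A 0 = (\<lambda>x y. if x = y then 1 else 0)"
| "matrix_power V A (Suc m) = matrix_times V A (matrix_power V A m)"

definition free_power_distance_matrix ::
    "'a set \<Rightarrow> 'a set set \<Rightarrow> 'a \<Rightarrow> nat \<Rightarrow> nat \<Rightarrow> ('a \<times> nat) list \<Rightarrow> ('a \<times> nat) list \<Rightarrow> real" where
  "free_power_distance_matrix V E e N k =
     adjacency_matrix (free_power_verts V e N)
       (distance_edges (free_power_verts V e N) (free_power_edges V E e N) k)"

definition is_vacuum_distribution ::
    "'a set \<Rightarrow> 'a \<Rightarrow> ('a \<Rightarrow> 'a \<Rightarrow> real) \<Rightarrow> real measure \<Rightarrow> bool" where
  "is_vacuum_distribution V e A \<mu> \<longleftrightarrow>
     real_distribution \<mu> \<and>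
     (\<forall>m::nat. integrable \<mu> (\<lambda>x. x ^ m) \<and> (\<integral>x. x ^ m \<partial>\<mu>) = matrix_power V A m e e)"

fun chebyshev_P :: "nat \<Rightarrow> real poly" where
  "chebyshev_P 0 = 1"
| "chebyshev_P (Suc 0) = [:0, 1:]"
| "chebyshev_P (Suc (Suc n)) = [:0, 1:] * chebyshev_P (Suc n) - chebyshev_P n"

definition semicircle_density :: "real \<Rightarrow> real" where
  "semicircle_density x = (if x \<in> {-2..2} then sqrt (4 - x\<^sup>2) / (2 * pi) else 0)"

end

theory Submission
  imports Defs "HOL-Library.Sublist"
begin

text \<open>
  Call a word generic if all its letters are neighbours of the root of \<open>G\<close>. The generic words form a
  tree (the parent of a word is its tail) in which every vertex has degree \<open>N \<sigma> + O(1)\<close>. In a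
  tree the distance-\<open>k\<close> operators \<open>T\<^sub>k\<close> satisfy \<open>T\<^sub>k\<^sub>+\<^sub>1 T = T\<^sub>k\<^sub>+\<^sub>2 + (N \<sigma> + O(1)) T\<^sub>k\<close>, so after
  normalisation they become \<open>P\<^sub>k(T)\<close>, while \<open>T\<close> itself acts on the normalised indicators \<open>\<xi>\<^sub>n\<close> of the
  generic words of length \<open>n\<close> by \<open>T \<xi>\<^sub>n = \<xi>\<^sub>n\<^sub>+\<^sub>1 + \<xi>\<^sub>n\<^sub>-\<^sub>1\<close>, like multiplication by \<open>x\<close> on the \<open>P\<^sub>n\<close>.

  The comparison of distances in the free power with distances in the tree takes place among functions
  dominated by \<open>h w = N powr (-|w|/2)\<close>, where \<open>|w|\<close> is the distance of \<open>w\<close> from the root.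
  The adjacency operator maps \<open>h\<close> to at most \<open>O(\<surd>N) h\<close>. A vertex on which the two distances disagree is reached from a generic
  word by a walk with a step outside the tree, and the sum of \<open>h\<close> over such vertices is smaller by a
  factor \<open>\<surd>N\<close>. Weak convergence follows by Levy's continuity theorem, since the moments of
  the limit grow at most geometrically.
\<close>

section \<open>Moments and weak convergence\<close>

text \<open>Pointwise convergence of characteristic functions suffices. The Taylor polynomial
  \<open>T n\<close> is built from moments and its remainder \<open>R n\<close> is governed by the
  moment of order \<open>n\<close>. The geometric bound makes \<open>R n L\<close> small for large
  \<open>n\<close>; for that fixed \<open>n\<close>, convergence of moments transfers the smallness
  to \<open>R n (M N)\<close>.\<close>

lemma weak_conv_m_of_moments:
  fixes M :: "nat \<Rightarrow> real measure" and L :: "real measure"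
  assumes M: "\<And>n. real_distribution (M n)" and L: "real_distribution L"
    and int_M: "\<And>n m. integrable (M n) (\<lambda>x. x ^ m)" and int_L: "\<And>m. integrable L (\<lambda>x. x ^ m)"
    and conv: "\<And>m. (\<lambda>n. \<integral>x. x ^ m \<partial>M n) \<longlonglongrightarrow> (\<integral>x. x ^ m \<partial>L)"
    and bound: "\<And>m. (\<integral>x. x ^ m \<partial>L) \<le> C ^ m"
  shows "weak_conv_m M L"
proof (rule levy_continuity[OF M L])
  fix t :: real
  define T where "T n \<nu> = (\<Sum>k\<le>n. ((\<i> * t) ^ k / fact k) * (\<integral>x. x ^ k \<partial>\<nu>))" for n and \<nu> :: "real measure"
  define R where "R n \<nu> = (2 * \<bar>t\<bar> ^ n / fact n) * (\<integral>x. x ^ n \<partial>\<nu>)" for n and \<nu> :: "real measure"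
  have approx: "cmod (char \<nu> t - T n \<nu>) \<le> R n \<nu>"
    if "real_distribution \<nu>" "\<And>m. integrable \<nu> (\<lambda>x. x ^ m)" "even n" for n \<nu>
    using real_distribution.char_approx1[OF that(1), of n t] that(2,3)
    by (simp add: T_def R_def power_even_abs)
  have T_lim: "(\<lambda>n. T k (M n)) \<longlonglongrightarrow> T k L" and R_lim: "(\<lambda>n. R k (M n)) \<longlonglongrightarrow> R k L" for k
    unfolding T_def R_def by (intro tendsto_intros conv)+
  show "(\<lambda>n. char (M n) t) \<longlonglongrightarrow> char L t"
  proof (rule metric_LIMSEQ_I)
    fix \<epsilon> :: real assume "\<epsilon> > 0"
    have "(\<lambda>n. (\<bar>t\<bar> * C) ^ n /\<^sub>R fact n) \<longlonglongrightarrow> 0"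
      by (rule summable_LIMSEQ_zero[OF summable_exp_generic])
    then have "eventually (\<lambda>n. (\<bar>t\<bar> * C) ^ n /\<^sub>R fact n < \<epsilon> / 4) sequentially"
      using \<open>\<epsilon> > 0\<close> by (intro order_tendstoD(2)[where y=0]) auto
    then obtain n0 where n0: "\<And>n. n \<ge> n0 \<Longrightarrow> (\<bar>t\<bar> * C) ^ n /\<^sub>R fact n < \<epsilon> / 4"
      by (auto simp: eventually_sequentially)
    \<comment> \<open>Doubling makes the order even, so that the absolute moment in the remainder is
      an ordinary moment.\<close>
    define n where "n = 2 * n0"
    have n: "even n" "n \<ge> n0" by (auto simp: n_def)
    have "R n L \<le> (2 * \<bar>t\<bar> ^ n / fact n) * C ^ n"
      unfolding R_def by (intro mult_left_mono bound) auto
    also have "\<dots> < \<epsilon> / 2"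
      using n0[OF n(2)] by (simp add: power_mult_distrib field_simps)
    finally have RL: "R n L < \<epsilon> / 2" .
    have "(\<lambda>N. R n (M N) + cmod (T n (M N) - T n L) + R n L) \<longlonglongrightarrow> R n L + cmod (T n L - T n L) + R n L"
      by (intro tendsto_intros R_lim T_lim)
    then have "eventually (\<lambda>N. R n (M N) + cmod (T n (M N) - T n L) + R n L < \<epsilon>) sequentially"
      by (rule order_tendstoD(2)) (use RL in simp)
    then have "eventually (\<lambda>N. dist (char (M N) t) (char L t) < \<epsilon>) sequentially"
    proof eventually_elim
      case (elim N)
      have "char (M N) t - char L t
          = (char (M N) t - T n (M N)) + (T n (M N) - T n L) - (char L t - T n L)" by simp
      then have "cmod (char (M N) t - char L t)
          \<le> cmod (char (M N) t - T n (M N)) + cmod (T n (M N) - T n L) + cmod (char L t - T n L)"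
        by (metis (no_types, lifting) add_mono_thms_linordered_semiring(3) norm_triangle_ineq
            norm_triangle_ineq4 order_trans)
      also have "\<dots> \<le> R n (M N) + cmod (T n (M N) - T n L) + R n L"
        by (intro add_mono approx M L int_M int_L n order_refl)
      finally show ?case using elim by (simp add: dist_norm)
    qed
    then show "\<exists>n0. \<forall>n\<ge>n0. dist (char (M n) t) (char L t) < \<epsilon>"
      by (simp add: eventually_sequentially)
  qed
qed

section \<open>The semicircle law and Chebyshev polynomials\<close>

text \<open>\<open>chebyshev_P n\<close> is the Chebyshev polynomial of the second kind rescaled to
  the interval from -2 to 2; its recursion is the addition formula for the sine.\<close>

lemma chebyshev_P_two_cos:
  "poly (chebyshev_P n) (2 * cos t) * sin t = sin (real (Suc n) * t)"
proof (induction n rule: chebyshev_P.induct)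
  case 2
  then show ?case by (simp add: sin_double)
next
  case (3 n)
  have "sin (real (Suc (Suc (Suc n))) * t) + sin (real (Suc n) * t)
      = 2 * cos t * sin (real (Suc (Suc n)) * t)"
    using sin_add[of "real (Suc (Suc n)) * t" t] sin_diff[of "real (Suc (Suc n)) * t" t]
    by (simp add: algebra_simps)
  moreover have "poly (chebyshev_P (Suc (Suc n))) (2 * cos t) * sin t
      = 2 * cos t * (poly (chebyshev_P (Suc n)) (2 * cos t) * sin t)
        - poly (chebyshev_P n) (2 * cos t) * sin t"
    by (simp add: algebra_simps)
  ultimately show ?case using 3 by simp
qed simp

lemma has_integral_chebyshev_P_semicircle:
  assumes "n \<ge> 1"
  shows "((\<lambda>x. semicircle_density x * poly (chebyshev_P n) x) has_integral 0) {-2..2}"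
proof -
  \<comment> \<open>With \<open>x = 2 * cos t\<close> the integrand is
    \<open>sin ((n + 1) t) / pi\<close> and \<open>dx = - 2 sin t dt\<close>; the product formula
    gives \<open>(cos ((n + 2) t) - cos (n t)) / pi\<close>, whose primitive is
    \<open>F\<close>.\<close>
  define F where "F x = (sin (real (n + 2) * arccos (x / 2)) / real (n + 2)
      - sin (real n * arccos (x / 2)) / real n) / pi" for x
  have "((\<lambda>x. semicircle_density x * poly (chebyshev_P n) x) has_integral (F 2 - F (-2))) {-2..2}"
  \<comment> \<open>\<open>arccos (x / 2)\<close> is not differentiable at the end points, where
    only continuity is asked for.\<close>
  proof (rule fundamental_theorem_of_calculus_interior)
    show "continuous_on {-2..2} F"
      unfolding F_def using assms by (intro continuous_intros) auto
    fix x :: real assume x: "x \<in> {-2<..<2}"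
    define t where "t = arccos (x / 2)"
    have cos_t: "cos t = x / 2" and "0 < t" "t < pi"
      using x arccos_lt_bounded[of "x / 2"] by (auto simp: t_def)
    then have sin_t: "sin t > 0" using sin_gt_zero by blast
    have sin_eq: "sin t = sqrt (1 - (x / 2)\<^sup>2)"
      using x unfolding t_def by (intro sin_arccos) auto
    define D where "D = - (inverse (sin t) / 2)"
    have arccos_D: "((\<lambda>x. arccos (x / 2)) has_real_derivative D) (at x)"
      unfolding D_def sin_eq using x by (auto intro!: derivative_eq_intros)
    have "(F has_real_derivative
        ((cos (real (n + 2) * t) * (real (n + 2) * D)) / real (n + 2)
          - (cos (real n * t) * (real n * D)) / real n) / pi) (at x)"
      unfolding F_def t_def
      by (intro DERIV_cdivide DERIV_diff DERIV_chain2[OF DERIV_sin] DERIV_cmult arccos_D)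
    also have "((cos (real (n + 2) * t) * (real (n + 2) * D)) / real (n + 2)
          - (cos (real n * t) * (real n * D)) / real n) / pi
        = (cos (real (n + 2) * t) * (- (inverse (sin t) / 2))
            - cos (real n * t) * (- (inverse (sin t) / 2))) / pi"
    proof -
      have "(x * (a * D) / a - y * (b * D) / b) / pi = (x * D - y * D) / pi"
        if "a \<noteq> 0" "b \<noteq> 0" for x y a b :: real using that by simp
      then show ?thesis using assms unfolding D_def[symmetric] by (simp only: of_nat_eq_0_iff)
    qed
    also have "(cos (real (n + 2) * t) * (- (inverse (sin t) / 2))
        - cos (real n * t) * (- (inverse (sin t) / 2))) / pi = sin (real (Suc n) * t) / pi"
    proof -
      have "cos (real n * t) - cos (real (n + 2) * t) = 2 * sin (real (Suc n) * t) * sin t"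
        using cos_add[of "real (Suc n) * t" t] cos_diff[of "real (Suc n) * t" t]
        by (simp add: algebra_simps)
      then show ?thesis using sin_t by (simp add: field_simps)
    qed
    also have "\<dots> = semicircle_density x * poly (chebyshev_P n) x"
    proof -
      have "sqrt (4 - x\<^sup>2) = 2 * sin t"
        unfolding sin_eq using real_sqrt_mult[of 4 "1 - (x / 2)\<^sup>2"] by (simp add: power_divide algebra_simps)
      then show ?thesis
        using x chebyshev_P_two_cos[of n t] by (simp add: semicircle_density_def cos_t mult.commute)
    qed
    finally show "(F has_vector_derivative semicircle_density x * poly (chebyshev_P n) x) (at x)"
      by (simp add: has_real_derivative_iff_has_vector_derivative)
  qed simp
  moreover have "F 2 = 0" "F (-2) = 0"
    using sin_npi[of n] sin_npi[of "n + 2"] by (simp_all add: F_def del: sin_npi of_nat_add)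
  ultimately show ?thesis by simp
qed

lemma semicircle_density_nonneg: "semicircle_density x \<ge> 0"
  unfolding semicircle_density_def by (auto simp: abs_le_iff abs_le_square_iff[of _ 2, simplified, symmetric] intro!: divide_nonneg_pos)

lemma set_integrable_semicircle_poly:
  "set_integrable lborel {-2..2} (\<lambda>x. semicircle_density x * poly p x)"
proof -
  have "continuous_on {-2..2::real} (\<lambda>x. sqrt (4 - x\<^sup>2) / (2 * pi) * poly p x)"
    by (intro continuous_intros) auto
  then have "continuous_on {-2..2::real} (\<lambda>x. semicircle_density x * poly p x)"
    by (rule continuous_on_eq) (simp add: semicircle_density_def)
  then show ?thesis by (intro borel_integrable_atLeastAtMost')
qed

lemma indicator_semicircle_poly:
  "indicator {-2..2} x *\<^sub>R (semicircle_density x * poly p x) = semicircle_density x * poly p x"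
  by (auto simp: semicircle_density_def)

locale semicircle_variable = prob_space \<Omega> for \<Omega> :: "'b measure" +
  fixes s :: "'b \<Rightarrow> real"
  assumes distributed_s: "distributed \<Omega> lborel s (\<lambda>x. ennreal (semicircle_density x))"
begin

definition mean :: "real poly \<Rightarrow> real" where
  "mean p = expectation (\<lambda>\<omega>. poly p (s \<omega>))"

lemma measurable_s [measurable]: "s \<in> borel_measurable \<Omega>"
  using distributed_measurable[OF distributed_s] by simp

lemma integrable_poly: "integrable \<Omega> (\<lambda>\<omega>. poly p (s \<omega>))"
proof -
  have "integrable lborel (\<lambda>x. semicircle_density x * poly p x)"
    using set_integrable_semicircle_poly[of p]
    unfolding set_integrable_def indicator_semicircle_poly .
  then show ?thesis
    by (subst distributed_integrable[OF distributed_s, symmetric])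
       (auto simp: semicircle_density_nonneg intro!: borel_measurable_continuous_onI continuous_intros)
qed

lemma mean_add: "mean (p + q) = mean p + mean q"
  by (simp add: mean_def integrable_poly)

text \<open>Orthogonality to the constant 1. For \<open>n = 0\<close> it is the total mass of
  \<open>\<Omega>\<close>, so the density need not be integrated.\<close>

lemma mean_chebyshev_P: "mean (chebyshev_P n) = (if n = 0 then 1 else 0)"
proof (cases "n = 0")
  case True
  then show ?thesis by (simp add: mean_def prob_space)
next
  case False
  have "mean (chebyshev_P n) = (LINT x|lborel. semicircle_density x * poly (chebyshev_P n) x)"
    unfolding mean_def
    by (rule distributed_integral[OF distributed_s, symmetric])
       (auto simp: semicircle_density_nonneg intro!: borel_measurable_continuous_onI continuous_intros)
  also have "\<dots> = (LINT x:{-2..2}|lborel. semicircle_density x * poly (chebyshev_P n) x)"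
    unfolding set_lebesgue_integral_def indicator_semicircle_poly ..
  also have "\<dots> = 0"
    using set_borel_integral_eq_integral(2)[OF set_integrable_semicircle_poly]
      has_integral_chebyshev_P_semicircle[of n] False by (simp add: integral_unique)
  finally show ?thesis using False by simp
qed

lemma AE_s_bounded: "AE \<omega> in \<Omega>. s \<omega> \<in> {-2..2}"
proof -
  have "AE x in density lborel (\<lambda>x. ennreal (semicircle_density x)). x \<in> {-2..2}"
    using distributed_borel_measurable[OF distributed_s]
    by (subst AE_density) (auto simp: semicircle_density_def)
  then have "AE x in distr \<Omega> lborel s. x \<in> {-2..2}"
    unfolding distributed_distr_eq_density[OF distributed_s] .
  then show ?thesis by (subst (asm) AE_distr_iff) auto
qed

text \<open>A polynomial is bounded on the compact support of the law. This supplies the growth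
  bound of \<open>weak_conv_m_of_moments\<close>.\<close>

lemma poly_moments_bounded: "\<exists>C. \<forall>m. mean (p ^ m) \<le> C ^ m"
proof -
  have "bounded (poly p ` {-2..2})"
    by (intro compact_imp_bounded compact_continuous_image continuous_intros) auto
  then obtain C where C: "\<And>x. x \<in> {-2..2} \<Longrightarrow> \<bar>poly p x\<bar> \<le> C"
    unfolding bounded_iff by (metis image_eqI real_norm_def)
  have "mean (p ^ m) \<le> C ^ m" for m
  proof -
    have "mean (p ^ m) \<le> expectation (\<lambda>_. C ^ m)"
      unfolding mean_def
    proof (rule integral_mono_AE[OF integrable_poly])
      show "AE \<omega> in \<Omega>. poly (p ^ m) (s \<omega>) \<le> C ^ m"
        using AE_s_bounded
      proof eventually_elim
        case (elim \<omega>)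
        have "poly (p ^ m) (s \<omega>) \<le> \<bar>poly p (s \<omega>)\<bar> ^ m"
          by (simp add: poly_power power_abs[symmetric])
        also have "\<dots> \<le> C ^ m" by (intro power_mono C elim) auto
        finally show ?case .
      qed
    qed simp
    then show ?thesis by (simp add: prob_space)
  qed
  then show ?thesis by blast
qed

end

section \<open>Chebyshev coefficients and the half-line\<close>

definition shift_sum :: "(nat \<Rightarrow> real) \<Rightarrow> nat \<Rightarrow> real" where
  "shift_sum a r = a (Suc r) + (if r = 0 then 0 else a (r - 1))"

text \<open>\<open>chebyshev_shift k\<close> is \<open>P\<^sub>k\<close> evaluated at the operator \<open>shift_sum\<close>, the adjacency operator of
  the half-line; it acts on the Chebyshev coefficients of a polynomial as multiplication by
  \<open>P\<^sub>k\<close>.\<close>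

fun chebyshev_shift :: "nat \<Rightarrow> (nat \<Rightarrow> real) \<Rightarrow> nat \<Rightarrow> real" where
  "chebyshev_shift 0 a = a"
| "chebyshev_shift (Suc 0) a = shift_sum a"
| "chebyshev_shift (Suc (Suc k)) a =
     (\<lambda>r. chebyshev_shift (Suc k) (shift_sum a) r - chebyshev_shift k a r)"

lemma tendsto_shift_sum:
  assumes "\<And>r. ((\<lambda>N. a N r) \<longlongrightarrow> b r) F"
  shows "((\<lambda>N. shift_sum (a N) r) \<longlongrightarrow> shift_sum b r) F"
  unfolding shift_sum_def by (auto intro!: tendsto_intros assms)

lemma tendsto_chebyshev_shift:
  assumes "\<And>r. ((\<lambda>N. a N r) \<longlongrightarrow> b r) F"
  shows "((\<lambda>N. chebyshev_shift k (a N) r) \<longlongrightarrow> chebyshev_shift k b r) F"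
  using assms
proof (induction k arbitrary: a b r rule: induct_nat_012)
  case (ge2 k)
  show ?case
    unfolding chebyshev_shift.simps
    by (intro tendsto_diff ge2.IH tendsto_shift_sum ge2.prems)
qed (auto intro: tendsto_shift_sum)

lemma chebyshev_shift_diff:
  "chebyshev_shift k (\<lambda>r. a r - b r) n = chebyshev_shift k a n - chebyshev_shift k b n"
proof (induction k arbitrary: a b n rule: induct_nat_012)
  case (ge2 k)
  have "shift_sum (\<lambda>r. a r - b r) = (\<lambda>r. shift_sum a r - shift_sum b r)"
    by (auto simp: shift_sum_def fun_eq_iff)
  then show ?case by (simp add: ge2)
qed (auto simp: shift_sum_def)

context semicircle_variable begin

text \<open>This is the three-term recursion \<open>x P_r = P_(r+1) + P_(r-1)\<close>; the value 0
  used by \<open>shift_sum\<close> at \<open>r = 0\<close> stands for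
  \<open>P_(-1) = 0\<close>.\<close>

lemma shift_sum_mean:
  "shift_sum (\<lambda>r. mean (q * chebyshev_P r)) = (\<lambda>r. mean ([:0, 1:] * q * chebyshev_P r))"
proof
  fix r
  show "shift_sum (\<lambda>r. mean (q * chebyshev_P r)) r = mean ([:0, 1:] * q * chebyshev_P r)"
  proof (cases r)
    case 0
    then show ?thesis by (simp add: shift_sum_def)
  next
    case (Suc n)
    have "[:0, 1:] * q * chebyshev_P r = q * chebyshev_P (Suc r) + q * chebyshev_P n"
      using Suc by (simp add: algebra_simps)
    then show ?thesis using Suc by (simp only: mean_add) (simp add: shift_sum_def)
  qed
qed

text \<open>The recursion of \<open>chebyshev_shift\<close> mirrors that of
  \<open>chebyshev_P\<close>. The factor \<open>q\<close> stays arbitrary because the inductive step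
  replaces it by \<open>x q\<close>.\<close>

lemma chebyshev_shift_mean:
  "chebyshev_shift k (\<lambda>r. mean (q * chebyshev_P r)) n = mean (chebyshev_P k * q * chebyshev_P n)"
proof (induction k arbitrary: q n rule: induct_nat_012)
  case 1
  then show ?case by (simp only: chebyshev_shift.simps shift_sum_mean) simp
next
  case (ge2 k)
  have "chebyshev_P (Suc k) * ([:0, 1:] * q) * chebyshev_P n
      = chebyshev_P (Suc (Suc k)) * q * chebyshev_P n + chebyshev_P k * q * chebyshev_P n"
    by (simp add: algebra_simps)
  then show ?case by (simp only: chebyshev_shift.simps shift_sum_mean ge2 mean_add)
qed simp

end

section \<open>The free power and its weighted walk counts\<close>

text \<open>The sum of both lengths minus twice the length of the longest common prefix: the path
  metric of the tree in which words grow at their end.\<close>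

fun prefix_dist :: "'a list \<Rightarrow> 'a list \<Rightarrow> nat" where
  "prefix_dist [] ys = length ys"
| "prefix_dist xs [] = length xs"
| "prefix_dist (x # xs) (y # ys) =
     (if x = y then prefix_dist xs ys else Suc (Suc (length xs + length ys)))"

lemma prefix_dist_snoc:
  "if prefix (ys @ [a]) xs then prefix_dist xs ys = Suc (prefix_dist xs (ys @ [a]))
   else prefix_dist xs (ys @ [a]) = Suc (prefix_dist xs ys)"
proof (induction xs ys rule: prefix_dist.induct)
  case (2 x xs)
  then show ?case by (cases xs) auto
qed auto

lemma prefix_dist_eq_0_iff: "prefix_dist xs ys = 0 \<longleftrightarrow> xs = ys"
  by (induction xs ys rule: prefix_dist.induct) auto

text \<open>The distance in the tree of words in which the parent of a word is its tail.\<close>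

definition word_dist :: "'a list \<Rightarrow> 'a list \<Rightarrow> nat" where
  "word_dist x y = prefix_dist (rev x) (rev y)"

lemma word_dist_eq_0_iff: "word_dist x y = 0 \<longleftrightarrow> x = y"
  by (simp add: word_dist_def prefix_dist_eq_0_iff)

lemma word_dist_Nil: "word_dist [] y = length y"
  by (simp add: word_dist_def)

lemma word_dist_Cons_suffix: "suffix (a # y) x \<Longrightarrow> word_dist x y = Suc (word_dist x (a # y))"
  using prefix_dist_snoc[of "rev y" a "rev x"] by (simp add: word_dist_def suffix_to_prefix)

lemma word_dist_Cons_not_suffix:
  "\<not> suffix (a # y) x \<Longrightarrow> word_dist x (a # y) = Suc (word_dist x y)"
  using prefix_dist_snoc[of "rev y" a "rev x"] by (simp add: word_dist_def suffix_to_prefix)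

lemma sum_Un_le:
  fixes f :: "'a \<Rightarrow> real"
  assumes "finite A" "finite B" "\<And>x. f x \<ge> 0"
  shows "sum f (A \<union> B) \<le> sum f A + sum f B"
  using sum.union_inter[OF assms(1,2), of f] sum_nonneg[of "A \<inter> B" f] assms(3) by simp

text \<open>The union is the image of the disjoint union \<open>SIGMA i:I. A i\<close> under
  \<open>snd\<close>; overlaps are merely counted more often on the right.\<close>

lemma sum_UN_le:
  fixes f :: "'a \<Rightarrow> real"
  assumes "finite I" "\<And>i. i \<in> I \<Longrightarrow> finite (A i)" "\<And>x. f x \<ge> 0" "B \<subseteq> (\<Union>i\<in>I. A i)"
  shows "sum f B \<le> (\<Sum>i\<in>I. sum f (A i))"
proof -
  have "sum f B \<le> sum f (snd ` (SIGMA i:I. A i))"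
    using assms by (intro sum_mono2) force+
  also have "\<dots> \<le> (\<Sum>p\<in>(SIGMA i:I. A i). f (snd p))"
    using assms sum_image_le[of "SIGMA i:I. A i" f snd] by (auto simp: o_def)
  also have "\<dots> = (\<Sum>i\<in>I. sum f (A i))"
    using assms by (subst sum.Sigma) (auto simp: case_prod_unfold)
  finally show ?thesis .
qed

section \<open>Distances from the root in \<open>G\<close>\<close>

locale rooted_graph =
  fixes V :: "'a set" and E :: "'a set set" and e :: 'a
  assumes finite_V: "finite V" and simple: "simple_graph V E" and connected: "connected_graph V E"
    and root_in: "e \<in> V" and card_V: "card V \<ge> 2"
begin

abbreviation adj :: "'a \<Rightarrow> 'a \<Rightarrow> bool" where "adj \<equiv> adjacent E"
abbreviation \<sigma> :: nat where "\<sigma> \<equiv> degree_in E e"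

definition root_nbrs :: "'a set" where "root_nbrs = {v. adj e v}"
definition root_dist :: "'a \<Rightarrow> nat" where "root_dist v = (LEAST n. (adj ^^ n) e v)"

lemma adj_sym: "adj u v \<Longrightarrow> adj v u"
  by (simp add: adjacent_def insert_commute)

lemma adj_in_V: "adj u v \<Longrightarrow> u \<in> V \<and> v \<in> V \<and> u \<noteq> v"
  using simple unfolding simple_graph_def adjacent_def by (metis doubleton_eq_iff)

lemma root_dist_walk: "v \<in> V \<Longrightarrow> (adj ^^ root_dist v) e v"
proof -
  assume "v \<in> V"
  then have "adj\<^sup>*\<^sup>* e v" using connected root_in by (auto simp: connected_graph_def)
  then obtain n where "(adj ^^ n) e v" by (auto dest: rtranclp_imp_relpowp)
  then show ?thesis unfolding root_dist_def by (rule LeastI)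
qed

lemma root_dist_le: "(adj ^^ n) e v \<Longrightarrow> root_dist v \<le> n"
  unfolding root_dist_def by (rule Least_le)

lemma root_dist_root: "root_dist e = 0"
  using root_dist_le[of 0 e] by simp

lemma root_dist_pos: "v \<in> V \<Longrightarrow> v \<noteq> e \<Longrightarrow> root_dist v \<ge> 1"
  using root_dist_walk[of v] by (cases "root_dist v") auto

lemma root_dist_adj: "adj u v \<Longrightarrow> root_dist v \<le> Suc (root_dist u)"
  using root_dist_walk[of u] adj_in_V[of u v] by (intro root_dist_le) auto

lemma root_dist_nbr: "v \<in> root_nbrs \<Longrightarrow> root_dist v = 1"
  using root_dist_adj[of e v] root_dist_pos[of v] adj_in_V[of e v]
  by (auto simp: root_nbrs_def root_dist_root)

lemma root_nbrs_subset: "root_nbrs \<subseteq> V - {e}"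
  using adj_in_V by (auto simp: root_nbrs_def)

lemma finite_root_nbrs: "finite root_nbrs"
  using root_nbrs_subset finite_V finite_subset by blast

lemma card_root_nbrs: "card root_nbrs = \<sigma>"
  by (simp add: root_nbrs_def degree_in_def)

lemma \<sigma>_pos: "\<sigma> \<ge> 1"
proof -
  have "\<not> V \<subseteq> {e}" using card_V finite_V card_mono[of "{e}" V] by auto
  then obtain v where v: "v \<in> V" "v \<noteq> e" by blast
  then have "adj\<^sup>*\<^sup>* e v" using connected root_in by (auto simp: connected_graph_def)
  then obtain u where "adj e u" using v(2) by (auto elim: converse_rtranclpE)
  then have "root_nbrs \<noteq> {}" by (auto simp: root_nbrs_def)
  then show ?thesis using finite_root_nbrs card_root_nbrs card_gt_0_iff[of root_nbrs] by simp
qed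

section \<open>Adjacency in the free power\<close>

abbreviation verts :: "nat \<Rightarrow> ('a \<times> nat) list set" where "verts \<equiv> free_power_verts V e"

abbreviation fadj :: "nat \<Rightarrow> ('a \<times> nat) list \<Rightarrow> ('a \<times> nat) list \<Rightarrow> bool" where
  "fadj N \<equiv> adjacent (free_power_edges V E e N)"

lemma verts_Nil: "[] \<in> verts N"
  by (simp add: free_power_verts_def)

lemma verts_Cons: "(v, i) # u \<in> verts N \<longleftrightarrow>
    v \<in> V - {e} \<and> i \<in> {1..N} \<and> u \<in> verts N \<and> (u \<noteq> [] \<longrightarrow> snd (hd u) \<noteq> i)"
  by (cases u) (auto simp: free_power_verts_def)

lemma fadj_sym: "fadj N x y \<Longrightarrow> fadj N y x"
  by (simp add: adjacent_def insert_commute)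

lemma fadj_iff: "fadj N x y \<longleftrightarrow> (\<exists>i u v v'. i \<in> {1..N} \<and> u \<in> verts N \<and>
    (u \<noteq> [] \<longrightarrow> snd (hd u) \<noteq> i) \<and> adj v v' \<and> x = attach e i v u \<and> y = attach e i v' u)"
  (is "?L \<longleftrightarrow> ?R")
proof
  assume ?L
  then obtain i u v v' where *: "i \<in> {1..N}" "u \<in> verts N" "u \<noteq> [] \<longrightarrow> snd (hd u) \<noteq> i"
      "adj v v'" "{x, y} = {attach e i v u, attach e i v' u}"
    unfolding adjacent_def free_power_edges_def by blast
  then show ?R using adj_sym[OF *(4)] unfolding doubleton_eq_iff by blast
next
  assume ?R
  then show ?L unfolding adjacent_def free_power_edges_def by blast
qed

lemma fadj_verts: "fadj N x y \<Longrightarrow> x \<in> verts N \<and> y \<in> verts N"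
  by (auto simp: fadj_iff attach_def verts_Cons dest: adj_in_V)

text \<open>An upper bound for the neighbours that add a letter: words repeating the index of the
  first letter of \<open>x\<close> are included although they are not vertices.\<close>

definition up_nbrs :: "nat \<Rightarrow> ('a \<times> nat) list \<Rightarrow> ('a \<times> nat) list set" where
  "up_nbrs N x = (\<lambda>p. p # x) ` (root_nbrs \<times> {1..N})"

text \<open>Moves inside the copy of \<open>G\<close> that carries the first letter; the letter
  disappears when it moves to \<open>e\<close>.\<close>

fun top_nbrs :: "('a \<times> nat) list \<Rightarrow> ('a \<times> nat) list set" where
  "top_nbrs [] = {}"
| "top_nbrs ((v, i) # u) = (\<lambda>v'. attach e i v' u) ` {v'. adj v v'}"

lemma fadj_cases: "fadj N x y \<Longrightarrow> y \<in> up_nbrs N x \<union> top_nbrs x"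
  unfolding fadj_iff up_nbrs_def root_nbrs_def
  by (auto simp: attach_def image_iff split: if_splits dest: adj_in_V)

section \<open>Weighted bounds for walks\<close>

definition weight :: "('a \<times> nat) list \<Rightarrow> nat" where
  "weight w = (\<Sum>p\<leftarrow>w. root_dist (fst p))"

lemma weight_simps [simp]: "weight [] = 0" "weight (p # w) = root_dist (fst p) + weight w"
  by (auto simp: weight_def)

text \<open>The weight for a Schur test: a word has at most \<open>\<sigma> N\<close> longer neighbours and boundedly
  many others, at most one step closer to the root, so one step of the walk multiplies \<open>h\<close> by \<open>O(\<surd>N)\<close>.\<close>

definition h :: "nat \<Rightarrow> ('a \<times> nat) list \<Rightarrow> real" where
  "h N w = (1 / sqrt (real N)) ^ weight w"

lemma h_nonneg: "h N w \<ge> 0" by (simp add: h_def)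

lemma h_antimono: "N \<ge> 1 \<Longrightarrow> weight x \<le> weight y \<Longrightarrow> h N y \<le> h N x"
  unfolding h_def by (intro power_decreasing) auto

lemma h_le_sqrt_mult:
  assumes "N \<ge> 1" "weight x \<le> Suc (weight y)"
  shows "h N y \<le> sqrt (real N) * h N x"
proof -
  have "(1 / sqrt (real N)) ^ Suc (weight y) \<le> h N x"
    unfolding h_def using assms by (intro power_decreasing) auto
  then show ?thesis using assms(1) by (simp add: h_def field_simps)
qed

text \<open>In \<open>sum_h_fadj\<close> the first summand accounts for \<open>up_nbrs\<close> and
  the second for \<open>top_nbrs\<close>.\<close>

definition growth :: real where "growth = real \<sigma> + real (card V)"

lemma growth_ge_1: "growth \<ge> 1" using \<sigma>_pos by (simp add: growth_def)

lemma finite_up_nbrs: "finite (up_nbrs N x)"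
  by (simp add: up_nbrs_def finite_root_nbrs)

lemma top_nbrs_finite_card: "finite (top_nbrs x) \<and> card (top_nbrs x) \<le> card V"
proof (cases x rule: top_nbrs.cases)
  case (2 v i u)
  have sub: "{v'. adj v v'} \<subseteq> V" using adj_in_V by auto
  then have fin: "finite {v'. adj v v'}" using finite_V finite_subset by blast
  have "card (top_nbrs x) \<le> card {v'. adj v v'}" using 2 card_image_le[OF fin] by simp
  also have "\<dots> \<le> card V" by (rule card_mono[OF finite_V sub])
  finally show ?thesis using fin 2 by simp
qed simp

lemma finite_fadj: "finite {y. fadj N x y}"
  by (rule finite_subset[of _ "up_nbrs N x \<union> top_nbrs x"])
     (auto simp: finite_up_nbrs top_nbrs_finite_card dest: fadj_cases)

lemma weight_top_nbrs: "y \<in> top_nbrs x \<Longrightarrow> weight x \<le> Suc (weight y)"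
  by (cases x rule: top_nbrs.cases)
     (auto simp: attach_def dest!: root_dist_adj[OF adj_sym] simp: root_dist_root)

lemma sum_h_fadj:
  assumes "N \<ge> 1"
  shows "(\<Sum>y | fadj N x y. h N y) \<le> growth * sqrt (real N) * h N x"
proof -
  have "(\<Sum>y | fadj N x y. h N y) \<le> (\<Sum>y\<in>up_nbrs N x \<union> top_nbrs x. h N y)"
    by (rule sum_mono2) (auto simp: finite_up_nbrs top_nbrs_finite_card h_nonneg dest: fadj_cases)
  also have "\<dots> \<le> (\<Sum>y\<in>up_nbrs N x. h N y) + (\<Sum>y\<in>top_nbrs x. h N y)"
    by (rule sum_Un_le) (auto simp: finite_up_nbrs top_nbrs_finite_card h_nonneg)
  also have "(\<Sum>y\<in>top_nbrs x. h N y) \<le> real (card V) * (sqrt (real N) * h N x)"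
  proof -
    have "(\<Sum>y\<in>top_nbrs x. h N y) \<le> real (card (top_nbrs x)) * (sqrt (real N) * h N x)"
      by (intro sum_bounded_above h_le_sqrt_mult assms weight_top_nbrs)
    also have "\<dots> \<le> real (card V) * (sqrt (real N) * h N x)"
      using top_nbrs_finite_card by (intro mult_right_mono) (auto simp: h_nonneg)
    finally show ?thesis .
  qed
  also have "(\<Sum>y\<in>up_nbrs N x. h N y) \<le> real \<sigma> * (sqrt (real N) * h N x)"
  proof -
    have "(\<Sum>y\<in>up_nbrs N x. h N y) = (\<Sum>p\<in>root_nbrs \<times> {1..N}. h N (p # x))"
      unfolding up_nbrs_def by (subst sum.reindex) (auto simp: inj_on_def)
    also have "\<dots> = (\<Sum>p\<in>root_nbrs \<times> {1..N}. h N x / sqrt (real N))"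
      by (rule sum.cong) (auto simp: h_def root_dist_nbr)
    also have "\<dots> = real \<sigma> * real N * (h N x / sqrt (real N))"
      by (simp add: card_cartesian_product card_root_nbrs)
    also have "\<dots> = real \<sigma> * (sqrt (real N) * h N x)"
      using assms by (simp add: field_simps)
    finally show ?thesis by simp
  qed
  finally show ?thesis by (simp add: growth_def algebra_simps)
qed

abbreviation reach :: "nat \<Rightarrow> nat \<Rightarrow> ('a \<times> nat) list \<Rightarrow> ('a \<times> nat) list set" where
  "reach N j x \<equiv> {y. (fadj N ^^ j) x y}"

lemma reach_Suc: "reach N (Suc j) x = (\<Union>z\<in>{z. fadj N x z}. reach N j z)"
  by (auto simp: relpowp_Suc_left simp del: relpowp.simps)

lemma finite_reach: "finite (reach N j x)"
proof (induction j arbitrary: x)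
  case (Suc j)
  then show ?case unfolding reach_Suc using finite_fadj by blast
qed simp

lemma reach_verts: "(fadj N ^^ j) x y \<Longrightarrow> x \<in> verts N \<Longrightarrow> y \<in> verts N"
  by (induction j arbitrary: y) (auto dest: fadj_verts)

lemma sum_h_reach:
  assumes "N \<ge> 1"
  shows "(\<Sum>y\<in>reach N j x. h N y) \<le> (growth * sqrt (real N)) ^ j * h N x"
proof (induction j arbitrary: x)
  case 0
  then show ?case by simp
next
  case (Suc j)
  have "(\<Sum>y\<in>reach N (Suc j) x. h N y) \<le> (\<Sum>z | fadj N x z. \<Sum>y\<in>reach N j z. h N y)"
    by (rule sum_UN_le) (auto simp: finite_fadj finite_reach h_nonneg reach_Suc simp del: relpowp.simps)
  also have "\<dots> \<le> (\<Sum>z | fadj N x z. (growth * sqrt (real N)) ^ j * h N z)"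
    by (intro sum_mono Suc)
  also have "\<dots> = (growth * sqrt (real N)) ^ j * (\<Sum>z | fadj N x z. h N z)"
    by (simp add: sum_distrib_left)
  also have "\<dots> \<le> (growth * sqrt (real N)) ^ j * (growth * sqrt (real N) * h N x)"
    using growth_ge_1 by (intro mult_left_mono sum_h_fadj assms) auto
  finally show ?case by (simp add: algebra_simps)
qed

section \<open>The tree of generic words\<close>

definition generic :: "nat \<Rightarrow> ('a \<times> nat) list set" where
  "generic N = {w \<in> verts N. fst ` set w \<subseteq> root_nbrs}"

lemma generic_verts: "x \<in> generic N \<Longrightarrow> x \<in> verts N"
  by (simp add: generic_def)

lemma generic_Nil: "[] \<in> generic N"
  by (simp add: generic_def verts_Nil)

lemma generic_Cons: "(v, i) # u \<in> generic N \<longleftrightarrow>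
    v \<in> root_nbrs \<and> i \<in> {1..N} \<and> u \<in> generic N \<and> (u \<noteq> [] \<longrightarrow> snd (hd u) \<noteq> i)"
  using root_nbrs_subset by (auto simp: generic_def verts_Cons)

lemma generic_tl: "a # u \<in> generic N \<Longrightarrow> u \<in> generic N"
  by (cases a) (simp add: generic_Cons)

lemma generic_suffix: "x \<in> generic N \<Longrightarrow> suffix y x \<Longrightarrow> y \<in> generic N"
proof -
  have "p @ y \<in> generic N \<Longrightarrow> y \<in> generic N" for p
    by (induction p) (auto dest: generic_tl)
  then show "x \<in> generic N \<Longrightarrow> suffix y x \<Longrightarrow> y \<in> generic N" by (auto simp: suffix_def)
qed

definition tadj :: "nat \<Rightarrow> ('a \<times> nat) list \<Rightarrow> ('a \<times> nat) list \<Rightarrow> bool" where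
  "tadj N x y \<longleftrightarrow> x \<in> generic N \<and> y \<in> generic N \<and> ((\<exists>a. y = a # x) \<or> (\<exists>a. x = a # y))"

lemma fadj_Cons: "a # x \<in> generic N \<Longrightarrow> fadj N x (a # x)"
proof (cases a)
  case (Pair v i)
  assume "a # x \<in> generic N"
  then have *: "v \<in> root_nbrs" "i \<in> {1..N}" "x \<in> verts N" "x \<noteq> [] \<longrightarrow> snd (hd x) \<noteq> i"
    using Pair by (auto simp: generic_Cons generic_verts)
  then have "v \<noteq> e" "adj e v" using root_nbrs_subset by (auto simp: root_nbrs_def)
  then show ?thesis unfolding fadj_iff using * Pair
    by (intro exI[of _ i] exI[of _ x] exI[of _ e] exI[of _ v]) (auto simp: attach_def)
qed

lemma tadj_imp_fadj: "tadj N x y \<Longrightarrow> fadj N x y"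
  by (auto simp: tadj_def intro: fadj_Cons fadj_sym)

lemma twalk_imp_fwalk: "(tadj N ^^ j) x y \<Longrightarrow> (fadj N ^^ j) x y"
  by (induction j arbitrary: y) (auto intro: tadj_imp_fadj)

lemma twalk_generic: "(tadj N ^^ j) x y \<Longrightarrow> x \<in> generic N \<Longrightarrow> y \<in> generic N"
  by (induction j arbitrary: y) (auto simp: tadj_def)

lemma finite_tadj: "finite {y. tadj N x y}"
  by (rule finite_subset[OF _ finite_fadj]) (auto dest: tadj_imp_fadj)

lemma word_dist_tadj:
  assumes "tadj N y z"
  shows "word_dist x z = Suc (word_dist x y) \<or> word_dist x y = Suc (word_dist x z)"
proof -
  have "word_dist x (a # w) = Suc (word_dist x w) \<or> word_dist x w = Suc (word_dist x (a # w))" for a w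
    using word_dist_Cons_suffix[of a w x] word_dist_Cons_not_suffix[of a w x] by blast
  then show ?thesis using assms by (auto simp: tadj_def)
qed

text \<open>The geodesic from \<open>y\<close> towards \<open>x\<close> has a unique first step: if
  \<open>y\<close> is a proper suffix of \<open>x\<close> it adds the next letter of
  \<open>x\<close>, and otherwise it drops the first letter of \<open>y\<close>.\<close>

lemma descending_tadj_card:
  assumes "x \<in> generic N" "y \<in> generic N"
  shows "card {z. tadj N y z \<and> word_dist x y = Suc (word_dist x z)} = (if x = y then 0 else 1)"
proof (cases "x = y")
  case True
  then have "word_dist x y = 0" by (simp add: word_dist_eq_0_iff)
  then show ?thesis using True by simp
next
  case False
  show ?thesis
  proof (cases "suffix y x")
    case True
    then obtain p where p: "x = p @ y" by (auto simp: suffix_def)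
    with False have "p \<noteq> []" by auto
    \<comment> \<open>\<open>last p\<close> is the letter of \<open>x\<close> directly in front of
      the suffix \<open>y\<close>.\<close>
    have suf: "suffix (a # y) x \<longleftrightarrow> a = last p" for a
    proof
      assume "suffix (a # y) x"
      then obtain q where "x = q @ a # y" by (auto simp: suffix_def)
      then have "p @ y = (q @ [a]) @ y" using p by simp
      then have "p = q @ [a]" by (rule append_same_eq[THEN iffD1])
      then show "a = last p" by simp
    next
      assume "a = last p"
      then have "x = butlast p @ a # y" using p \<open>p \<noteq> []\<close> append_butlast_last_id[of p]
        by (metis append.assoc append_Cons append_Nil)
      then show "suffix (a # y) x" by (auto simp: suffix_def)
    qed
    have eq: "{z. tadj N y z \<and> word_dist x y = Suc (word_dist x z)} = {last p # y}" (is "?L = ?R")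
    proof
      show "?R \<subseteq> ?L"
        using suf assms generic_suffix[OF assms(1)] word_dist_Cons_suffix[of "last p" y x]
        by (auto simp: tadj_def)
      show "?L \<subseteq> ?R"
      proof safe
        fix z assume z: "tadj N y z" "word_dist x y = Suc (word_dist x z)"
        show "z = last p # y"
        proof (cases "\<exists>a. z = a # y")
          case True
          then obtain a where "z = a # y" ..
          then show ?thesis using suf[of a] word_dist_Cons_not_suffix[of a y x] z(2) by auto
        next
          case False
          then obtain a where "y = a # z" using z by (auto simp: tadj_def)
          then show ?thesis using z word_dist_Cons_suffix[of a z x] \<open>suffix y x\<close> by simp
        qed
      qed
    qed
    show ?thesis unfolding eq using False by simp
  next
    case not_suf: False
    then have "y \<noteq> []" by auto
    then obtain b y' where y: "y = b # y'" by (meson neq_Nil_conv)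
    have eq: "{z. tadj N y z \<and> word_dist x y = Suc (word_dist x z)} = {y'}" (is "?L = ?R")
    proof
      show "?R \<subseteq> ?L"
        using word_dist_Cons_not_suffix[of b y' x] not_suf y assms(2) generic_tl[of b y' N]
        by (simp add: tadj_def)
      show "?L \<subseteq> ?R"
      proof safe
        fix z assume z: "tadj N y z" "word_dist x y = Suc (word_dist x z)"
        have "\<not> suffix (a # y) x" for a
          using not_suf suffix_ConsD[of a y x] by blast
        then have "z \<noteq> a # y" for a using word_dist_Cons_not_suffix[of a y x] z(2) by auto
        then show "z = y'" using z(1) y by (auto simp: tadj_def)
      qed
    qed
    show ?thesis unfolding eq using False by simp
  qed
qed

lemma twalk_word_dist: "(tadj N ^^ j) x y \<Longrightarrow> word_dist x y \<le> j"
proof (induction j arbitrary: y)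
  case 0
  then show ?case by (simp add: word_dist_eq_0_iff)
next
  case (Suc j)
  then obtain z where "(tadj N ^^ j) x z" "tadj N z y" by auto
  then show ?case using Suc.IH[of z] word_dist_tadj[of N z y x] by auto
qed

text \<open>Descending neighbours are followed from \<open>y\<close> down to \<open>x\<close>. With
  \<open>twalk_word_dist\<close> this identifies \<open>word_dist\<close> as the graph distance of
  the tree.\<close>

lemma word_dist_twalk:
  "x \<in> generic N \<Longrightarrow> y \<in> generic N \<Longrightarrow> word_dist x y = j \<Longrightarrow> (tadj N ^^ j) x y"
proof (induction j arbitrary: y)
  case 0
  then show ?case by (simp add: word_dist_eq_0_iff)
next
  case (Suc j)
  then have "x \<noteq> y" using word_dist_eq_0_iff[of x y] by auto
  then have "{z. tadj N y z \<and> word_dist x y = Suc (word_dist x z)} \<noteq> {}"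
    using descending_tadj_card[of x N y] Suc.prems by (metis card.empty zero_neq_one)
  then obtain z where "tadj N y z" "word_dist x z = j" using Suc.prems by auto
  then have "z \<in> generic N" "tadj N z y" by (simp_all add: tadj_def disj_commute)
  then show ?case using Suc.IH[of z] Suc.prems(1) \<open>word_dist x z = j\<close> by auto
qed

end

section \<open>Tree spheres and distance spheres\<close>

text \<open>A finite value excludes the empty set, whose infimum is \<infinity>, and the infimum of
  a nonempty set of extended naturals is attained.\<close>

lemma graph_dist_eq_enat_iff:
  "graph_dist E u v = enat k \<longleftrightarrow> (adjacent E ^^ k) u v \<and> (\<forall>j<k. \<not> (adjacent E ^^ j) u v)"
proof -
  let ?A = "{enat n | n. (adjacent E ^^ n) u v}"
  show ?thesis
  proof
    assume eq: "graph_dist E u v = enat k"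
    then have Inf_eq: "Inf ?A = enat k" by (simp add: graph_dist_def)
    then have "?A \<noteq> {}" by (metis Inf_enat_def enat.distinct(1))
    then have "enat k \<in> ?A" using Inf_eq wellorder_InfI by (metis (lifting) ex_in_conv)
    moreover have "k \<le> j" if "(adjacent E ^^ j) u v" for j
    proof -
      have "Inf ?A \<le> enat j" using that by (intro Inf_lower) auto
      then show ?thesis using Inf_eq by simp
    qed
    ultimately show "(adjacent E ^^ k) u v \<and> (\<forall>j<k. \<not> (adjacent E ^^ j) u v)"
      using not_le by auto
  next
    assume *: "(adjacent E ^^ k) u v \<and> (\<forall>j<k. \<not> (adjacent E ^^ j) u v)"
    show "graph_dist E u v = enat k"
      unfolding graph_dist_def
    proof (rule antisym)
      show "Inf ?A \<le> enat k" using * by (intro Inf_lower) auto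
      show "enat k \<le> Inf ?A" using * by (intro Inf_greatest) (auto simp: not_less[symmetric])
    qed
  qed
qed

context rooted_graph begin

definition tsphere :: "nat \<Rightarrow> nat \<Rightarrow> ('a \<times> nat) list \<Rightarrow> ('a \<times> nat) list set" where
  "tsphere N k x = {y \<in> generic N. word_dist x y = k}"

lemma tsphere_subset_reach: "x \<in> generic N \<Longrightarrow> tsphere N k x \<subseteq> reach N k x"
  by (auto simp: tsphere_def intro: twalk_imp_fwalk word_dist_twalk)

lemma finite_tsphere: "x \<in> generic N \<Longrightarrow> finite (tsphere N k x)"
  by (rule finite_subset[OF tsphere_subset_reach finite_reach])

lemma tsphere_0: "x \<in> generic N \<Longrightarrow> tsphere N 0 x = {x}"
  by (auto simp: tsphere_def word_dist_eq_0_iff)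

lemma tsphere_1:
  assumes "x \<in> generic N"
  shows "tsphere N (Suc 0) x = {y. tadj N x y}"
proof safe
  fix y assume "y \<in> tsphere N (Suc 0) x"
  then show "tadj N x y"
    using word_dist_twalk[OF assms, of y 1] by (auto simp: tsphere_def)
next
  fix y assume y: "tadj N x y"
  then have "word_dist x y = Suc 0"
    using word_dist_tadj[OF y, of x] by (simp add: word_dist_eq_0_iff[THEN iffD2])
  then show "y \<in> tsphere N (Suc 0) x" using y by (simp add: tsphere_def tadj_def)
qed

lemma card_tadj_le: "card {z. tadj N y z} \<le> \<sigma> * N + 1"
proof -
  \<comment> \<open>The parent of \<open>y\<close> gives the summand 1; for \<open>y = []\<close>
    the inserted \<open>tl y\<close> is \<open>[]\<close> itself, which is harmless.\<close>
  have sub: "{z. tadj N y z} \<subseteq> insert (tl y) (up_nbrs N y)"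
    by (auto simp: tadj_def up_nbrs_def image_iff generic_Cons)
  have "card {z. tadj N y z} \<le> card (insert (tl y) (up_nbrs N y))"
    by (rule card_mono[OF _ sub]) (simp add: finite_up_nbrs)
  also have "\<dots> \<le> Suc (card (up_nbrs N y))" by (rule card_insert_le_m1) auto
  also have "card (up_nbrs N y) \<le> card (root_nbrs \<times> {1..N})"
    unfolding up_nbrs_def by (rule card_image_le) (simp add: finite_root_nbrs)
  finally show ?thesis by (simp add: card_cartesian_product card_root_nbrs)
qed

lemma card_tadj_ge:
  assumes "y \<in> generic N"
  shows "\<sigma> * (N - 1) \<le> card {z. tadj N y z}"
proof -
  \<comment> \<open>The new letter must not repeat the index of the first letter. For
    \<open>y = []\<close> the removed value is unspecified, but at most one index is lost.\<close>
  define I where "I = {1..N} - {snd (hd y)}"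
  have "\<sigma> * (N - 1) \<le> card (root_nbrs \<times> I)"
    using diff_card_le_card_Diff[of "{snd (hd y)}" "{1..N}"]
    by (simp add: card_cartesian_product card_root_nbrs I_def)
  also have "\<dots> = card ((\<lambda>p. p # y) ` (root_nbrs \<times> I))"
    by (rule card_image[symmetric]) (auto simp: inj_on_def)
  also have "\<dots> \<le> card {z. tadj N y z}"
    by (rule card_mono[OF finite_tadj]) (use assms in \<open>auto simp: tadj_def I_def generic_Cons\<close>)
  finally show ?thesis .
qed

text \<open>Every neighbour ascends or descends and at most one descends, so the count differs by at
  most 1 from a degree lying between \<open>\<sigma> * (N - 1)\<close> and
  \<open>\<sigma> * N + 1\<close>.\<close>

lemma card_ascending_tadj:
  assumes "x \<in> generic N" "y \<in> generic N" "N \<ge> 1"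
  shows "\<bar>real (card {z. tadj N y z \<and> word_dist x z = Suc (word_dist x y)}) - real N * real \<sigma>\<bar>
    \<le> real \<sigma> + 1"
proof -
  let ?A = "{z. tadj N y z \<and> word_dist x z = Suc (word_dist x y)}"
  let ?D = "{z. tadj N y z \<and> word_dist x y = Suc (word_dist x z)}"
  have Un: "{z. tadj N y z} = ?A \<union> ?D"
    using word_dist_tadj[of N y _ x] by (simp add: set_eq_iff) metis
  have "finite ?A" "finite ?D" by (rule finite_subset[OF _ finite_tadj]; blast)+
  moreover have "?A \<inter> ?D = {}" by auto
  ultimately have "card {z. tadj N y z} = card ?A + card ?D"
    unfolding Un by (rule card_Un_disjoint)
  moreover have "card ?D \<le> 1" using descending_tadj_card[OF assms(1,2)] by simp
  ultimately have le: "card ?A \<le> \<sigma> * N + 1" and ge: "\<sigma> * (N - 1) \<le> card ?A + 1"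
    using card_tadj_le[of N y] card_tadj_ge[OF assms(2)] by linarith+
  have "real (card ?A) \<le> real (\<sigma> * N + 1)" "real (\<sigma> * (N - 1)) \<le> real (card ?A + 1)"
    using le ge of_nat_le_iff by blast+
  moreover have "real (\<sigma> * (N - 1)) = real N * real \<sigma> - real \<sigma>"
    using assms(3) by (simp add: of_nat_diff algebra_simps)
  ultimately show ?thesis by (simp add: abs_le_iff algebra_simps)
qed

text \<open>Double counting of tree edges from the sphere of radius \<open>k + 1\<close>: a point at
  radius \<open>k + 2\<close> has one neighbour there, and a point at radius \<open>k\<close> has
  \<open>N \<sigma>\<close> of them up to an error of \<open>\<sigma> + 1\<close>.\<close>

lemma tsphere_recursion:
  fixes f :: "('a \<times> nat) list \<Rightarrow> real"
  assumes x: "x \<in> generic N" and "N \<ge> 1"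
  shows "\<bar>(\<Sum>z\<in>tsphere N (Suc k) x. \<Sum>y | tadj N z y. f y) - (\<Sum>y\<in>tsphere N (Suc (Suc k)) x. f y)
      - real N * real \<sigma> * (\<Sum>y\<in>tsphere N k x. f y)\<bar>
    \<le> (real \<sigma> + 1) * (\<Sum>y\<in>tsphere N k x. \<bar>f y\<bar>)"
proof -
  let ?S = "\<lambda>k. tsphere N k x"
  let ?A = "\<lambda>y. {z. tadj N y z \<and> word_dist x z = Suc (word_dist x y)}"
  have split: "{y. tadj N z y} = {y. y \<in> ?S (Suc (Suc k)) \<union> ?S k \<and> tadj N z y}" if "z \<in> ?S (Suc k)" for z
  proof -
    have "y \<in> ?S (Suc (Suc k)) \<union> ?S k" if "tadj N z y" for y
      using word_dist_tadj[OF that, of x] that \<open>z \<in> ?S (Suc k)\<close> by (auto simp: tsphere_def tadj_def)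
    then show ?thesis by blast
  qed
  have "(\<Sum>z\<in>?S (Suc k). \<Sum>y | tadj N z y. f y)
      = (\<Sum>z\<in>?S (Suc k). \<Sum>y | y \<in> ?S (Suc (Suc k)) \<union> ?S k \<and> tadj N z y. f y)"
    using split by (intro sum.cong) auto
  also have "\<dots> = (\<Sum>y\<in>?S (Suc (Suc k)) \<union> ?S k. \<Sum>z | z \<in> ?S (Suc k) \<and> tadj N z y. f y)"
    by (rule sum.swap_restrict) (auto simp: finite_tsphere x)
  also have "\<dots> = (\<Sum>y\<in>?S (Suc (Suc k)). \<Sum>z | z \<in> ?S (Suc k) \<and> tadj N z y. f y)
      + (\<Sum>y\<in>?S k. \<Sum>z | z \<in> ?S (Suc k) \<and> tadj N z y. f y)"
    by (rule sum.union_disjoint[OF finite_tsphere[OF x] finite_tsphere[OF x]]) (auto simp: tsphere_def)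
  also have "(\<Sum>y\<in>?S (Suc (Suc k)). \<Sum>z | z \<in> ?S (Suc k) \<and> tadj N z y. f y) = (\<Sum>y\<in>?S (Suc (Suc k)). f y)"
  proof (rule sum.cong)
    fix y assume y: "y \<in> ?S (Suc (Suc k))"
    then have "x \<noteq> y" using word_dist_eq_0_iff[of x y] by (auto simp: tsphere_def)
    moreover have "{z. z \<in> ?S (Suc k) \<and> tadj N z y} = {z. tadj N y z \<and> word_dist x y = Suc (word_dist x z)}"
      using y by (auto simp: tsphere_def tadj_def)
    ultimately show "(\<Sum>z | z \<in> ?S (Suc k) \<and> tadj N z y. f y) = f y"
      using descending_tadj_card[OF x, of y] y by (simp add: tsphere_def)
  qed simp
  also have "(\<Sum>y\<in>?S k. \<Sum>z | z \<in> ?S (Suc k) \<and> tadj N z y. f y) = (\<Sum>y\<in>?S k. real (card (?A y)) * f y)"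
  proof (rule sum.cong)
    fix y assume y: "y \<in> ?S k"
    have "{z. z \<in> ?S (Suc k) \<and> tadj N z y} = ?A y"
      using y by (auto simp: tsphere_def tadj_def)
    then show "(\<Sum>z | z \<in> ?S (Suc k) \<and> tadj N z y. f y) = real (card (?A y)) * f y" by simp
  qed simp
  finally have "(\<Sum>z\<in>?S (Suc k). \<Sum>y | tadj N z y. f y) - (\<Sum>y\<in>?S (Suc (Suc k)). f y)
      - real N * real \<sigma> * (\<Sum>y\<in>?S k. f y) = (\<Sum>y\<in>?S k. (real (card (?A y)) - real N * real \<sigma>) * f y)"
    by (simp add: sum_distrib_left left_diff_distrib sum_subtractf)
  also have "\<bar>\<dots>\<bar> \<le> (\<Sum>y\<in>?S k. \<bar>(real (card (?A y)) - real N * real \<sigma>) * f y\<bar>)" by (rule sum_abs)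
  also have "\<dots> \<le> (\<Sum>y\<in>?S k. (real \<sigma> + 1) * \<bar>f y\<bar>)"
    unfolding abs_mult
    by (intro sum_mono mult_right_mono card_ascending_tadj x assms(2)) (auto simp: tsphere_def)
  finally show ?thesis by (simp add: sum_distrib_left)
qed

section \<open>Normalised sphere operators and their limits\<close>

definition rescale :: "nat \<Rightarrow> real" where "rescale N = 1 / sqrt (real N * real \<sigma>)"

lemma rescale_nonneg: "rescale N \<ge> 0" by (simp add: rescale_def)

lemma rescale_square: "N \<ge> 1 \<Longrightarrow> rescale N * rescale N * (real N * real \<sigma>) = 1"
  using \<sigma>_pos by (simp add: rescale_def)

lemma rescale_le: "N \<ge> 1 \<Longrightarrow> rescale N \<le> 1 / sqrt (real N)"
  unfolding rescale_def using \<sigma>_pos by (intro divide_left_mono) (auto simp: mult_le_cancel_left1)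

text \<open>Not a mean value: the divisor is the square root of \<open>(N \<sigma>)^k\<close>, the
  scaling of the distance-\<open>k\<close> operator, whatever the size of
  \<open>Y x\<close>.\<close>

definition avg :: "nat \<Rightarrow> nat \<Rightarrow> (('a \<times> nat) list \<Rightarrow> ('a \<times> nat) list set) \<Rightarrow>
    (('a \<times> nat) list \<Rightarrow> real) \<Rightarrow> ('a \<times> nat) list \<Rightarrow> real" where
  "avg N k Y f x = rescale N ^ k * (\<Sum>y\<in>Y x. f y)"

text \<open>The factor \<open>sqrt N ^ k\<close> in \<open>sum_h_reach\<close> cancels against
  \<open>rescale N ^ k\<close>, so the resulting constant does not depend on
  \<open>N\<close>.\<close>

lemma avg_abs_bound:
  assumes "N \<ge> 1" "Y x \<subseteq> reach N k x" "C \<ge> 0" "\<And>y. y \<in> Y x \<Longrightarrow> \<bar>f y\<bar> \<le> C * h N y"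
  shows "avg N k Y (\<lambda>y. \<bar>f y\<bar>) x \<le> C * growth ^ k * h N x"
proof -
  have "(\<Sum>y\<in>Y x. \<bar>f y\<bar>) \<le> C * (\<Sum>y\<in>Y x. h N y)"
    unfolding sum_distrib_left by (intro sum_mono assms)
  also have "(\<Sum>y\<in>Y x. h N y) \<le> (\<Sum>y\<in>reach N k x. h N y)"
    by (rule sum_mono2) (use assms finite_reach h_nonneg in auto)
  also have "\<dots> \<le> (growth * sqrt (real N)) ^ k * h N x" by (rule sum_h_reach[OF assms(1)])
  finally have "(\<Sum>y\<in>Y x. \<bar>f y\<bar>) \<le> C * ((growth * sqrt (real N)) ^ k * h N x)"
    using assms(3) by (simp add: mult_left_mono)
  then have "avg N k Y (\<lambda>y. \<bar>f y\<bar>) x \<le> (1 / sqrt (real N)) ^ k * (C * ((growth * sqrt (real N)) ^ k * h N x))"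
    unfolding avg_def by (intro mult_mono power_mono rescale_le assms) (auto simp: rescale_nonneg sum_nonneg)
  also have "\<dots> = C * growth ^ k * h N x"
    using assms(1) by (simp add: power_mult_distrib power_divide field_simps)
  finally show ?thesis .
qed

lemma avg_abs: "\<bar>avg N k Y f x\<bar> \<le> avg N k Y (\<lambda>y. \<bar>f y\<bar>) x"
  unfolding avg_def abs_mult using rescale_nonneg by (simp add: mult_left_mono)

lemma avg_bound:
  assumes "N \<ge> 1" "Y x \<subseteq> reach N k x" "C \<ge> 0" "\<And>y. y \<in> Y x \<Longrightarrow> \<bar>f y\<bar> \<le> C * h N y"
  shows "\<bar>avg N k Y f x\<bar> \<le> C * growth ^ k * h N x"
  using avg_abs avg_abs_bound[where Y = Y and f = f, OF assms] by (rule order_trans)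

definition h_bounded :: "(nat \<Rightarrow> ('a \<times> nat) list \<Rightarrow> real) \<Rightarrow> bool" where
  "h_bounded f \<longleftrightarrow> (\<exists>C\<ge>0. \<forall>N\<ge>1. \<forall>w\<in>verts N. \<bar>f N w\<bar> \<le> C * h N w)"

lemma h_bounded_avg:
  assumes "h_bounded f" "\<And>N x. x \<in> verts N \<Longrightarrow> Y N x \<subseteq> reach N k x"
  shows "h_bounded (\<lambda>N. avg N k (Y N) (f N))"
proof -
  obtain C where C: "C \<ge> 0" "\<And>N w. N \<ge> 1 \<Longrightarrow> w \<in> verts N \<Longrightarrow> \<bar>f N w\<bar> \<le> C * h N w"
    using assms(1) by (auto simp: h_bounded_def)
  have "\<bar>avg N k (Y N) (f N) x\<bar> \<le> C * growth ^ k * h N x" if "N \<ge> 1" "x \<in> verts N" for N x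
    using that assms(2)[OF that(2)] C(1) by (intro avg_bound C(2)) (auto dest!: reach_verts)
  then show ?thesis
    unfolding h_bounded_def using C(1) growth_ge_1 by (intro exI[of _ "C * growth ^ k"]) auto
qed

text \<open>\<open>ell N n\<close> pairs a function with the normalised indicator of the generic words of length \<open>n\<close>,
  which plays the role of \<open>P\<^sub>n\<close>.\<close>

abbreviation ell :: "nat \<Rightarrow> nat \<Rightarrow> (('a \<times> nat) list \<Rightarrow> real) \<Rightarrow> real" where
  "ell N n f \<equiv> avg N n (tsphere N n) f []"

lemma ell_diff: "ell N n (\<lambda>x. f x - g x) = ell N n f - ell N n g"
  by (simp add: avg_def sum_subtractf right_diff_distrib)

lemma ell_bound:
  assumes "N \<ge> 1" "C \<ge> 0" "\<And>x. x \<in> generic N \<Longrightarrow> \<bar>f x\<bar> \<le> C * h N x"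
  shows "\<bar>ell N n f\<bar> \<le> C * growth ^ n"
proof -
  have "\<bar>ell N n f\<bar> \<le> C * growth ^ n * h N []"
    using assms by (intro avg_bound tsphere_subset_reach generic_Nil) (auto simp: tsphere_def)
  then show ?thesis by (simp add: h_def)
qed

lemma ell_tendsto_0:
  assumes "\<And>N x. N \<ge> 1 \<Longrightarrow> x \<in> generic N \<Longrightarrow> \<bar>g N x\<bar> \<le> \<epsilon> N * h N x" "\<epsilon> \<longlonglongrightarrow> 0" "\<And>N. \<epsilon> N \<ge> 0"
  shows "(\<lambda>N. ell N n (g N)) \<longlonglongrightarrow> 0"
proof (rule Lim_null_comparison)
  show "\<forall>\<^sub>F N in sequentially. norm (ell N n (g N)) \<le> \<epsilon> N * growth ^ n"
    using eventually_ge_at_top[of 1] by eventually_elim (auto intro!: ell_bound assms)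
  show "(\<lambda>N. \<epsilon> N * growth ^ n) \<longlonglongrightarrow> 0" using assms(2) by (rule tendsto_mult_left_zero)
qed

abbreviation tstep :: "nat \<Rightarrow> (('a \<times> nat) list \<Rightarrow> real) \<Rightarrow> ('a \<times> nat) list \<Rightarrow> real" where
  "tstep N \<equiv> avg N (Suc 0) (\<lambda>x. {y. tadj N x y})"

lemma h_bounded_tstep: "h_bounded f \<Longrightarrow> h_bounded (\<lambda>N. tstep N (f N))"
  by (rule h_bounded_avg) (auto simp: relpowp_Suc_left intro: tadj_imp_fadj)

text \<open>Multiplication of \<open>tsphere_recursion\<close> by \<open>rescale N ^ (k + 2)\<close>
  turns the coefficient \<open>N \<sigma>\<close> into 1, while the bounded counting error acquires
  the factor \<open>rescale N ^ 2 \<le> 1 / N\<close>.\<close>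

lemma avg_tsphere_recursion:
  assumes "N \<ge> 1" "x \<in> generic N" "C \<ge> 0" "\<And>w. w \<in> verts N \<Longrightarrow> \<bar>f w\<bar> \<le> C * h N w"
  shows "\<bar>avg N (Suc k) (tsphere N (Suc k)) (tstep N f) x
      - avg N (Suc (Suc k)) (tsphere N (Suc (Suc k))) f x - avg N k (tsphere N k) f x\<bar>
    \<le> (real \<sigma> + 1) * C * growth ^ k / real N * h N x" (is "\<bar>?L\<bar> \<le> ?R")
proof -
  have "?L = rescale N ^ k * (rescale N * rescale N) * ((\<Sum>z\<in>tsphere N (Suc k) x. \<Sum>y | tadj N z y. f y)
      - (\<Sum>y\<in>tsphere N (Suc (Suc k)) x. f y))
      - rescale N ^ k * (rescale N * rescale N * (real N * real \<sigma>)) * (\<Sum>y\<in>tsphere N k x. f y)"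
    unfolding rescale_square[OF assms(1)] by (simp add: avg_def sum_distrib_left algebra_simps)
  also have "\<dots> = rescale N ^ k * (rescale N * rescale N) * ((\<Sum>z\<in>tsphere N (Suc k) x. \<Sum>y | tadj N z y. f y)
      - (\<Sum>y\<in>tsphere N (Suc (Suc k)) x. f y) - real N * real \<sigma> * (\<Sum>y\<in>tsphere N k x. f y))"
    by (simp add: algebra_simps)
  finally have "\<bar>?L\<bar> \<le> rescale N ^ k * (rescale N * rescale N) * ((real \<sigma> + 1) * (\<Sum>y\<in>tsphere N k x. \<bar>f y\<bar>))"
    using tsphere_recursion[OF assms(2,1), where k = k and f = f] rescale_nonneg[of N]
    by (simp add: abs_mult mult_left_mono)
  also have "\<dots> = (rescale N * rescale N) * (real \<sigma> + 1) * avg N k (tsphere N k) (\<lambda>y. \<bar>f y\<bar>) x"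
    by (simp add: avg_def algebra_simps)
  also have "\<dots> \<le> (1 / real N) * (real \<sigma> + 1) * (C * growth ^ k * h N x)"
  proof (intro mult_mono)
    have "rescale N * rescale N \<le> (1 / sqrt (real N)) * (1 / sqrt (real N))"
      by (intro mult_mono rescale_le assms rescale_nonneg) auto
    then show "rescale N * rescale N \<le> 1 / real N" by simp
    show "avg N k (tsphere N k) (\<lambda>y. \<bar>f y\<bar>) x \<le> C * growth ^ k * h N x"
      using assms by (intro avg_abs_bound tsphere_subset_reach) (auto simp: tsphere_def generic_verts)
    show "0 \<le> avg N k (tsphere N k) (\<lambda>y. \<bar>f y\<bar>) x"
      by (auto simp: avg_def rescale_nonneg intro!: mult_nonneg_nonneg sum_nonneg)
  qed auto
  finally show ?thesis by (simp add: field_simps)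
qed

text \<open>\<open>avg_tsphere_recursion\<close> read at the empty word: moved onto the spheres, one
  tree step acts on their radius as \<open>shift_sum\<close>. At radius 0 the identity is
  exact.\<close>

lemma ell_tstep:
  assumes "h_bounded f"
  shows "(\<lambda>N. ell N n (tstep N (f N)) - shift_sum (\<lambda>r. ell N r (f N)) n) \<longlonglongrightarrow> 0"
proof (cases n)
  case 0
  have "ell N 0 (tstep N (f N)) = ell N 1 (f N)" for N
    by (simp add: avg_def tsphere_0 tsphere_1 generic_Nil)
  then show ?thesis using 0 by (simp add: shift_sum_def)
next
  case (Suc k)
  obtain C where C: "C \<ge> 0" "\<And>N w. N \<ge> 1 \<Longrightarrow> w \<in> verts N \<Longrightarrow> \<bar>f N w\<bar> \<le> C * h N w"
    using assms by (auto simp: h_bounded_def)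
  show ?thesis
  proof (rule Lim_null_comparison)
    show "\<forall>\<^sub>F N in sequentially. norm (ell N n (tstep N (f N)) - shift_sum (\<lambda>r. ell N r (f N)) n)
        \<le> ((real \<sigma> + 1) * C * growth ^ k) / real N"
      using eventually_ge_at_top[of 1]
    proof eventually_elim
      case (elim N)
      show ?case
        using avg_tsphere_recursion[OF elim generic_Nil C(1) C(2)[OF elim], where k = k] Suc
        by (simp add: shift_sum_def h_def diff_diff_eq)
    qed
  qed (rule lim_const_over_n)
qed

text \<open>Up to errors tending to 0, the operators satisfy
  \<open>T_(k+2) f = T_(k+1) (T f) - T_k f\<close>, the recursion defining
  \<open>chebyshev_shift\<close>. The function \<open>f\<close> is generalised because the induction
  hypothesis is applied to \<open>T f\<close>.\<close>

lemma ell_avg_tsphere: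
  assumes "h_bounded f"
  shows "(\<lambda>N. ell N n (avg N k (tsphere N k) (f N)) - chebyshev_shift k (\<lambda>r. ell N r (f N)) n) \<longlonglongrightarrow> 0"
  using assms
proof (induction k arbitrary: f n rule: induct_nat_012)
  case 0
  have "ell N n (avg N 0 (tsphere N 0) (f N)) = ell N n (f N)" for N
    by (auto simp: avg_def tsphere_0 tsphere_def[of N n] intro!: sum.cong)
  then show ?case by simp
next
  case 1
  have "ell N n (avg N (Suc 0) (tsphere N (Suc 0)) (f N)) = ell N n (tstep N (f N))" for N
    by (auto simp: avg_def tsphere_1 tsphere_def[of N n] intro!: sum.cong)
  then show ?case using ell_tstep[OF 1] by simp
next
  case (ge2 k)
  let ?t = "\<lambda>N. tstep N (f N)"
  let ?T = "\<lambda>k f N. avg N k (tsphere N k) (f N)"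
  obtain C where C: "C \<ge> 0" "\<And>N w. N \<ge> 1 \<Longrightarrow> w \<in> verts N \<Longrightarrow> \<bar>f N w\<bar> \<le> C * h N w"
    using ge2.prems by (auto simp: h_bounded_def)
  have 1: "(\<lambda>N. ell N n (\<lambda>x. ?T (Suc k) ?t N x - ?T (Suc (Suc k)) f N x - ?T k f N x)) \<longlonglongrightarrow> 0"
  proof (rule ell_tendsto_0)
    show "(\<lambda>N. (real \<sigma> + 1) * C * growth ^ k / real N) \<longlonglongrightarrow> 0" by (rule lim_const_over_n)
    show "0 \<le> (real \<sigma> + 1) * C * growth ^ k / real N" for N using C(1) growth_ge_1 by simp
  qed (intro avg_tsphere_recursion C)
  have 2: "(\<lambda>N. ell N n (?T (Suc k) ?t N) - chebyshev_shift (Suc k) (\<lambda>r. ell N r (?t N)) n) \<longlonglongrightarrow> 0"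
    by (rule ge2.IH(2)[OF h_bounded_tstep[OF ge2.prems]])
  have 3: "(\<lambda>N. ell N n (?T k f N) - chebyshev_shift k (\<lambda>r. ell N r (f N)) n) \<longlonglongrightarrow> 0"
    by (rule ge2.IH(1)[OF ge2.prems])
  \<comment> \<open>Linearity and continuity of \<open>chebyshev_shift\<close> carry the error of
    \<open>ell_tstep\<close> at all radii through to radius \<open>n\<close>.\<close>
  have "(\<lambda>N. chebyshev_shift (Suc k) (\<lambda>r. ell N r (?t N) - shift_sum (\<lambda>r. ell N r (f N)) r) n)
      \<longlonglongrightarrow> chebyshev_shift (Suc k) (\<lambda>r. 0) n"
    by (intro tendsto_chebyshev_shift ell_tstep ge2.prems)
  moreover have "chebyshev_shift (Suc k) (\<lambda>r. 0) n = 0"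
    using chebyshev_shift_diff[of "Suc k" "\<lambda>r. 0" "\<lambda>r. 0" n] by simp
  ultimately have 4: "(\<lambda>N. chebyshev_shift (Suc k) (\<lambda>r. ell N r (?t N)) n
      - chebyshev_shift (Suc k) (shift_sum (\<lambda>r. ell N r (f N))) n) \<longlonglongrightarrow> 0"
    by (simp add: chebyshev_shift_diff)
  show ?case
    using tendsto_add[OF tendsto_diff[OF tendsto_diff[OF 2 1] 3] 4]
    unfolding ell_diff by (simp add: algebra_simps)
qed

text \<open>A step of a walk that leaves the tree of generic words has boundedly many choices and does not
  decrease the distance to the root, which loses a factor \<open>\<surd>N\<close> against the bound for all walks.\<close>

lemma sum_h_wild_walks:
  assumes "N \<ge> 1" "x \<in> generic N"
  shows "sqrt (real N) * (\<Sum>y | (fadj N ^^ j) x y \<and> \<not> (tadj N ^^ j) x y. h N y)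
    \<le> real j * (growth * sqrt (real N)) ^ j * h N x"
  using assms(2)
proof (induction j arbitrary: x)
  case 0
  then show ?case by simp
next
  case (Suc j)
  let ?X = "\<lambda>j x. {y. (fadj N ^^ j) x y \<and> \<not> (tadj N ^^ j) x y}"
  let ?W = "{z. fadj N x z \<and> \<not> tadj N x z}"
  let ?r = "sqrt (real N)"
  have r: "?r \<ge> 0" by simp
  have fin: "finite (?X j z)" for j z using finite_reach[where N = N and j = j and x = z] by auto
  have finW: "finite ?W" using finite_fadj[of N x] by auto
  \<comment> \<open>Adding a root neighbour or deleting the first letter would be a tree step. So
    the first letter, at distance 1 from \<open>e\<close>, moves to another non-root vertex of its
    copy of \<open>G\<close>.\<close>
  have W: "z \<in> top_nbrs x \<and> weight x \<le> weight z" if z: "z \<in> ?W" for z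
  proof -
    have "z \<in> verts N" using z fadj_verts by blast
    have not_up: "z \<notin> up_nbrs N x"
    proof
      assume "z \<in> up_nbrs N x"
      then obtain p where "z = p # x" "fst p \<in> root_nbrs" by (auto simp: up_nbrs_def)
      then have "z \<in> generic N" using \<open>z \<in> verts N\<close> Suc.prems by (auto simp: generic_def)
      then show False using z \<open>z = p # x\<close> Suc.prems by (cases p) (auto simp: tadj_def)
    qed
    then have top: "z \<in> top_nbrs x" using z fadj_cases by blast
    then obtain v i u v' where x: "x = (v, i) # u" and z': "z = attach e i v' u" and "adj v v'"
      by (cases x rule: top_nbrs.cases) auto
    have "v' \<noteq> e"
    proof
      assume "v' = e"
      then have "z = u" using z' by (simp add: attach_def)
      then have "tadj N x z" using Suc.prems x generic_tl by (auto simp: tadj_def)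
      then show False using z by simp
    qed
    then have "root_dist v' \<ge> 1" using \<open>adj v v'\<close> adj_in_V root_dist_pos by blast
    then have "weight x \<le> weight z"
      using x z' \<open>v' \<noteq> e\<close> Suc.prems by (simp add: attach_def generic_Cons root_dist_nbr)
    then show ?thesis using top by simp
  qed
  \<comment> \<open>Split by the first step: after a step outside the tree the rest is arbitrary;
    after a tree step the end point cannot be reached from \<open>z\<close> by a tree walk of length
    \<open>j\<close>.\<close>
  have "?X (Suc j) x \<subseteq> (\<Union>z\<in>?W. reach N j z) \<union> (\<Union>z\<in>{z. tadj N x z}. ?X j z)"
    by (auto simp: relpowp_Suc_left simp del: relpowp.simps)
  then have "(\<Sum>y\<in>?X (Suc j) x. h N y)
      \<le> (\<Sum>y\<in>(\<Union>z\<in>?W. reach N j z) \<union> (\<Union>z\<in>{z. tadj N x z}. ?X j z). h N y)"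
    using finW finite_tadj[of N x] fin finite_reach h_nonneg by (intro sum_mono2) auto
  also have "\<dots> \<le> (\<Sum>y\<in>(\<Union>z\<in>?W. reach N j z). h N y) + (\<Sum>y\<in>(\<Union>z\<in>{z. tadj N x z}. ?X j z). h N y)"
    by (rule sum_Un_le) (auto simp: finW finite_tadj fin finite_reach h_nonneg)
  also have "(\<Sum>y\<in>(\<Union>z\<in>?W. reach N j z). h N y) \<le> (\<Sum>z\<in>?W. \<Sum>y\<in>reach N j z. h N y)"
    by (rule sum_UN_le) (auto simp: finW finite_reach h_nonneg)
  also have "\<dots> \<le> (\<Sum>z\<in>?W. (growth * ?r) ^ j * h N x)"
  proof (rule sum_mono)
    fix z assume "z \<in> ?W"
    then have "h N z \<le> h N x" using W assms(1) by (intro h_antimono) auto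
    then show "(\<Sum>y\<in>reach N j z. h N y) \<le> (growth * ?r) ^ j * h N x"
      using sum_h_reach[OF assms(1), of j z] growth_ge_1
      by (meson mult_left_mono order_trans zero_le_power mult_nonneg_nonneg r zero_le_one)
  qed
  also have "\<dots> \<le> growth * ((growth * ?r) ^ j * h N x)"
  proof -
    have "card ?W \<le> card (top_nbrs x)" using W top_nbrs_finite_card by (intro card_mono) auto
    then have "card ?W \<le> card V" using top_nbrs_finite_card[of x] by linarith
    then have "real (card ?W) \<le> growth" by (simp add: growth_def)
    then show ?thesis
      using growth_ge_1 h_nonneg[of N x] by (simp add: mult_right_mono)
  qed
  also have "(\<Sum>y\<in>(\<Union>z\<in>{z. tadj N x z}. ?X j z). h N y) \<le> (\<Sum>z | tadj N x z. \<Sum>y\<in>?X j z. h N y)"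
    by (rule sum_UN_le) (auto simp: finite_tadj fin h_nonneg)
  finally have "?r * (\<Sum>y\<in>?X (Suc j) x. h N y)
      \<le> ?r * (growth * ((growth * ?r) ^ j * h N x) + (\<Sum>z | tadj N x z. \<Sum>y\<in>?X j z. h N y))"
    by (simp add: mult_left_mono)
  also have "\<dots> = (growth * ?r) ^ Suc j * h N x + (\<Sum>z | tadj N x z. ?r * (\<Sum>y\<in>?X j z. h N y))"
    by (simp add: distrib_left sum_distrib_left)
  also have "(\<Sum>z | tadj N x z. ?r * (\<Sum>y\<in>?X j z. h N y))
      \<le> (\<Sum>z | tadj N x z. real j * (growth * ?r) ^ j * h N z)"
    by (intro sum_mono Suc.IH) (auto simp: tadj_def)
  also have "\<dots> = real j * (growth * ?r) ^ j * (\<Sum>z | tadj N x z. h N z)"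
    by (simp add: sum_distrib_left)
  also have "\<dots> \<le> real j * (growth * ?r) ^ j * (growth * ?r * h N x)"
  proof (rule mult_left_mono)
    have "(\<Sum>z | tadj N x z. h N z) \<le> (\<Sum>z | fadj N x z. h N z)"
      by (rule sum_mono2) (auto simp: finite_fadj h_nonneg intro: tadj_imp_fadj)
    then show "(\<Sum>z | tadj N x z. h N z) \<le> growth * ?r * h N x"
      using sum_h_fadj[OF assms(1), of x] by linarith
    show "0 \<le> real j * (growth * ?r) ^ j" using growth_ge_1 by simp
  qed
  finally show ?case by (simp add: algebra_simps)
qed

section \<open>Distance spheres against tree spheres\<close>

definition dist_sphere :: "nat \<Rightarrow> nat \<Rightarrow> ('a \<times> nat) list \<Rightarrow> ('a \<times> nat) list set" where
  "dist_sphere N k x = {y. graph_dist (free_power_edges V E e N) x y = enat k}"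

lemma dist_sphere_subset_reach: "dist_sphere N k x \<subseteq> reach N k x"
  by (auto simp: dist_sphere_def graph_dist_eq_enat_iff)

lemma finite_dist_sphere: "finite (dist_sphere N k x)"
  by (rule finite_subset[OF dist_sphere_subset_reach finite_reach])

text \<open>Tree walks are walks of the free power. If only the graph distance is \<open>k\<close>,
  a tree walk of length \<open>k\<close> would force tree distance \<open>k\<close> or a shorter
  walk. If only the tree distance is \<open>k\<close>, some walk is shorter than \<open>k\<close>,
  which no tree walk can be.\<close>

lemma dist_sphere_tsphere_diff:
  assumes "x \<in> generic N" and y: "y \<in> (dist_sphere N k x - tsphere N k x) \<union> (tsphere N k x - dist_sphere N k x)"
  shows "\<exists>j\<le>k. (fadj N ^^ j) x y \<and> \<not> (tadj N ^^ j) x y"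
  using y
proof
  assume *: "y \<in> dist_sphere N k x - tsphere N k x"
  then have walk: "(fadj N ^^ k) x y" and min: "\<And>j. j < k \<Longrightarrow> \<not> (fadj N ^^ j) x y"
    by (auto simp: dist_sphere_def graph_dist_eq_enat_iff)
  have "\<not> (tadj N ^^ k) x y"
  proof
    assume t: "(tadj N ^^ k) x y"
    then have gen: "y \<in> generic N" using twalk_generic assms by blast
    have "\<not> word_dist x y < k"
      using min twalk_imp_fwalk word_dist_twalk[OF assms(1) gen refl] by blast
    then have "word_dist x y = k" using twalk_word_dist[OF t] by simp
    then show False using * gen by (simp add: tsphere_def)
  qed
  then show ?thesis using walk by blast
next
  assume *: "y \<in> tsphere N k x - dist_sphere N k x"
  then have dist: "word_dist x y = k" by (simp add: tsphere_def)
  have "(fadj N ^^ k) x y" using * tsphere_subset_reach assms by blast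
  then obtain j where "j < k" "(fadj N ^^ j) x y"
    using * by (auto simp: dist_sphere_def graph_dist_eq_enat_iff)
  moreover have "\<not> (tadj N ^^ j) x y" using twalk_word_dist[of j N x y] dist \<open>j < k\<close> by auto
  ultimately show ?thesis using less_imp_le by blast
qed

lemma avg_dist_sphere_tsphere:
  assumes "N \<ge> 1" "x \<in> generic N" "C \<ge> 0" "\<And>w. w \<in> verts N \<Longrightarrow> \<bar>f w\<bar> \<le> C * h N w"
  shows "\<bar>avg N k (dist_sphere N k) f x - avg N k (tsphere N k) f x\<bar>
    \<le> C * real (k * Suc k) * growth ^ k / sqrt (real N) * h N x"
proof -
  let ?S = "dist_sphere N k x" and ?T = "tsphere N k x" and ?r = "sqrt (real N)"
  let ?X = "\<lambda>j. {y. (fadj N ^^ j) x y \<and> \<not> (tadj N ^^ j) x y}"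
  let ?D = "(?S - ?T) \<union> (?T - ?S)"
  have finS: "finite ?S" and finT: "finite ?T" using finite_dist_sphere finite_tsphere assms by auto
  have r: "?r \<ge> 1" using assms(1) by simp
  have "sum f ?S - sum f ?T = sum f (?S - ?T) - sum f (?T - ?S)"
    using sum.Int_Diff[OF finS, of f ?T] sum.Int_Diff[OF finT, of f ?S] by (simp add: Int_commute)
  also have "\<bar>\<dots>\<bar> \<le> (\<Sum>y\<in>?S - ?T. \<bar>f y\<bar>) + (\<Sum>y\<in>?T - ?S. \<bar>f y\<bar>)"
    using sum_abs[of f "?S - ?T"] sum_abs[of f "?T - ?S"] by linarith
  also have "\<dots> = (\<Sum>y\<in>?D. \<bar>f y\<bar>)"
    by (rule sum.union_disjoint[symmetric]) (use finS finT in auto)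
  also have "\<dots> \<le> (\<Sum>y\<in>?D. C * h N y)"
  proof (rule sum_mono)
    fix y assume "y \<in> ?D"
    then obtain j where "(fadj N ^^ j) x y" using dist_sphere_tsphere_diff[OF assms(2)] by blast
    then show "\<bar>f y\<bar> \<le> C * h N y" using assms(2,4) reach_verts generic_verts by blast
  qed
  also have "\<dots> = C * (\<Sum>y\<in>?D. h N y)" by (simp add: sum_distrib_left)
  also have "(\<Sum>y\<in>?D. h N y) \<le> (\<Sum>j\<le>k. \<Sum>y\<in>?X j. h N y)"
  proof (rule sum_UN_le)
    show "?D \<subseteq> (\<Union>j\<in>{..k}. ?X j)" using dist_sphere_tsphere_diff[OF assms(2)] by blast
    show "finite (?X j)" for j using finite_reach[where N = N and j = j and x = x] by auto
  qed (auto simp: h_nonneg)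
  \<comment> \<open>Each length \<open>j\<close> is bounded by its worst case \<open>j = k\<close>;
    the \<open>k + 1\<close> lengths then produce the constant \<open>k * Suc k\<close>.\<close>
  also have "\<dots> \<le> (\<Sum>j\<le>k. real k * (growth * ?r) ^ k * h N x / ?r)"
  proof (rule sum_mono)
    fix j assume "j \<in> {..k}"
    then have "real j * (growth * ?r) ^ j * h N x \<le> real k * (growth * ?r) ^ k * h N x"
      using r growth_ge_1 mult_mono[of 1 growth 1 ?r]
      by (intro mult_right_mono mult_mono power_increasing) (auto simp: h_nonneg)
    then have "?r * (\<Sum>y\<in>?X j. h N y) \<le> real k * (growth * ?r) ^ k * h N x"
      using sum_h_wild_walks[OF assms(1,2), of j] by linarith
    then show "(\<Sum>y\<in>?X j. h N y) \<le> real k * (growth * ?r) ^ k * h N x / ?r"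
      using r by (simp add: field_simps)
  qed
  also have "\<dots> = real (k * Suc k) * (growth * ?r) ^ k * h N x / ?r" by (simp add: algebra_simps)
  finally have "\<bar>sum f ?S - sum f ?T\<bar> \<le> C * (real (k * Suc k) * (growth * ?r) ^ k * h N x / ?r)"
    using assms(3) by (simp add: mult_left_mono)
  then have "rescale N ^ k * \<bar>sum f ?S - sum f ?T\<bar>
      \<le> (1 / ?r) ^ k * (C * (real (k * Suc k) * (growth * ?r) ^ k * h N x / ?r))"
    by (intro mult_mono power_mono rescale_le rescale_nonneg assms) auto
  also have "\<dots> = C * real (k * Suc k) * growth ^ k / ?r * h N x"
    using r by (simp add: power_mult_distrib power_divide field_simps)
  finally show ?thesis
    using rescale_nonneg[of N] by (simp add: avg_def abs_mult right_diff_distrib[symmetric])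
qed

lemma ell_avg_dist_sphere:
  assumes "h_bounded f"
  shows "(\<lambda>N. ell N n (avg N k (dist_sphere N k) (f N)) - chebyshev_shift k (\<lambda>r. ell N r (f N)) n) \<longlonglongrightarrow> 0"
proof -
  obtain C where C: "C \<ge> 0" "\<And>N w. N \<ge> 1 \<Longrightarrow> w \<in> verts N \<Longrightarrow> \<bar>f N w\<bar> \<le> C * h N w"
    using assms by (auto simp: h_bounded_def)
  have "(\<lambda>N. ell N n (\<lambda>x. avg N k (dist_sphere N k) (f N) x - avg N k (tsphere N k) (f N) x)) \<longlonglongrightarrow> 0"
  proof (rule ell_tendsto_0)
    show "(\<lambda>N. C * real (k * Suc k) * growth ^ k / sqrt (real N)) \<longlonglongrightarrow> 0"
      by (intro real_tendsto_divide_at_top[OF tendsto_const]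
          filterlim_compose[OF sqrt_at_top] filterlim_real_sequentially)
    show "0 \<le> C * real (k * Suc k) * growth ^ k / sqrt (real N)" for N using C(1) growth_ge_1 by simp
  qed (intro avg_dist_sphere_tsphere C)
  from tendsto_add[OF this ell_avg_tsphere[OF assms, of n k]]
  show ?thesis by (simp add: ell_diff)
qed

end

section \<open>Vacuum moments\<close>

lemma relpowp_sym:
  assumes "\<And>x y. R x y \<Longrightarrow> R y x"
  shows "(R ^^ n) x y \<Longrightarrow> (R ^^ n) y x"
proof (induction n arbitrary: y)
  case (Suc n)
  then obtain z where "(R ^^ n) x z" "R z y" by auto
  then show ?case using Suc.IH assms relpowp_Suc_I2[of R y z n x] by blast
qed simp

lemma graph_dist_sym: "graph_dist E x y = graph_dist E y x"
proof -
  have "(adjacent E ^^ n) x y \<longleftrightarrow> (adjacent E ^^ n) y x" for n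
    by (intro iffI; rule relpowp_sym) (auto simp: adjacent_def insert_commute)
  then show ?thesis by (simp add: graph_dist_def)
qed

lemma matrix_power_scale:
  "matrix_power V (\<lambda>x y. a * A x y) m x y = a ^ m * matrix_power V A m x y"
proof (induction m arbitrary: x)
  case (Suc m)
  have "matrix_power V (\<lambda>x y. a * A x y) (Suc m) x y
      = (\<Sum>\<^sub>\<infinity>z\<in>V. a ^ Suc m * (A x z * matrix_power V A m z y))"
    by (simp add: matrix_times_def Suc mult_ac)
  then show ?case by (simp add: infsum_cmult_right' matrix_times_def)
qed simp

lemma powr_minus_half: "x > 0 \<Longrightarrow> x powr (- real n / 2) = (1 / sqrt x) ^ n"
proof -
  assume x: "x > 0"
  have "(1 / sqrt x) ^ n = (x powr (- 1 / 2)) ^ n"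
    using x by (simp add: powr_minus_divide powr_half_sqrt)
  also have "\<dots> = x powr (- 1 / 2 * real n)"
    using x by (subst powr_realpow[symmetric]) (auto simp: powr_powr)
  finally show ?thesis by simp
qed

context rooted_graph begin

lemma distance_matrix_eq:
  assumes "x \<in> verts N" "z \<in> verts N"
  shows "free_power_distance_matrix V E e N k x z = (if z \<in> dist_sphere N k x then 1 else 0)"
proof -
  have "{x, z} \<in> distance_edges (verts N) (free_power_edges V E e N) k \<longleftrightarrow> z \<in> dist_sphere N k x"
    using assms graph_dist_sym[of "free_power_edges V E e N" x z]
    by (auto simp: distance_edges_def dist_sphere_def doubleton_eq_iff)
  then show ?thesis
    using assms by (simp add: free_power_distance_matrix_def adjacency_matrix_def)
qed

text \<open>The row of \<open>x\<close> is supported on the finite set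
  \<open>dist_sphere N k x\<close>, so the infinite sum becomes a finite one.\<close>

lemma matrix_power_distance_Suc:
  assumes "x \<in> verts N"
  shows "matrix_power (verts N) (free_power_distance_matrix V E e N k) (Suc m) x y
    = (\<Sum>z\<in>dist_sphere N k x. matrix_power (verts N) (free_power_distance_matrix V E e N k) m z y)"
proof -
  let ?A = "free_power_distance_matrix V E e N k"
  have sub: "dist_sphere N k x \<subseteq> verts N"
    using dist_sphere_subset_reach reach_verts assms by blast
  have "matrix_power (verts N) ?A (Suc m) x y
      = (\<Sum>\<^sub>\<infinity>z\<in>verts N. ?A x z * matrix_power (verts N) ?A m z y)"
    by (simp add: matrix_times_def)
  also have "\<dots> = (\<Sum>\<^sub>\<infinity>z\<in>dist_sphere N k x. matrix_power (verts N) ?A m z y)"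
    by (rule infsum_cong_neutral) (use sub assms in \<open>auto simp: distance_matrix_eq\<close>)
  finally show ?thesis by (simp add: finite_dist_sphere)
qed

text \<open>The \<open>m\<close>-th power of the normalised distance matrix applied to the indicator
  of the root; its entry at \<open>[]\<close> is the vacuum moment.\<close>

definition vacuum_vector :: "nat \<Rightarrow> nat \<Rightarrow> nat \<Rightarrow> ('a \<times> nat) list \<Rightarrow> real" where
  "vacuum_vector k m N x =
     rescale N ^ (k * m) * matrix_power (verts N) (free_power_distance_matrix V E e N k) m x []"

lemma vacuum_vector_Suc:
  "x \<in> verts N \<Longrightarrow>
     vacuum_vector k (Suc m) N x = avg N k (dist_sphere N k) (vacuum_vector k m N) x"
  unfolding vacuum_vector_def avg_def matrix_power_distance_Suc
  by (simp add: sum_distrib_left power_add mult_ac)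

lemma h_bounded_vacuum_vector: "h_bounded (vacuum_vector k m)"
proof (induction m)
  case 0
  have "\<bar>vacuum_vector k 0 N w\<bar> \<le> 1 * h N w" for N w
    by (simp add: vacuum_vector_def h_nonneg) (simp add: h_def)
  then show ?case unfolding h_bounded_def by (intro exI[of _ 1]) auto
next
  case (Suc m)
  have "h_bounded (\<lambda>N. avg N k (dist_sphere N k) (vacuum_vector k m N))"
    by (rule h_bounded_avg[OF Suc dist_sphere_subset_reach])
  then show ?case by (simp add: h_bounded_def vacuum_vector_Suc)
qed

end

locale rooted_graph_semicircle = rooted_graph V E e + semicircle_variable \<Omega> s
  for V :: "'a set" and E e and \<Omega> :: "'b measure" and s
begin

text \<open>The limits are the Chebyshev coefficients of \<open>P_k^m\<close>: the indicator of the
  root has those of the constant 1, and each further matrix factor multiplies by \<open>P_k\<close>.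
  All \<open>n\<close> are treated at once because \<open>chebyshev_shift\<close> mixes
  coefficients.\<close>

lemma ell_vacuum_vector:
  "(\<lambda>N. ell N n (vacuum_vector k m N)) \<longlonglongrightarrow> mean (chebyshev_P k ^ m * chebyshev_P n)"
proof (induction m arbitrary: n)
  case 0
  have "ell N n (vacuum_vector k 0 N) = (if n = 0 then 1 else 0)" for N
  proof -
    have "(\<Sum>y\<in>tsphere N n []. vacuum_vector k 0 N y) = (\<Sum>y\<in>tsphere N n []. if y = [] then 1 else 0)"
      by (simp add: vacuum_vector_def)
    also have "\<dots> = (if n = 0 then 1 else 0)"
      using finite_tsphere[OF generic_Nil] by (auto simp: tsphere_def word_dist_Nil generic_Nil)
    finally show ?thesis by (simp add: avg_def)
  qed
  then show ?case by (simp add: mean_chebyshev_P)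
next
  case (Suc m)
  have eq: "ell N n (vacuum_vector k (Suc m) N)
      = ell N n (avg N k (dist_sphere N k) (vacuum_vector k m N))" for N
    unfolding avg_def[of N n]
    by (intro arg_cong2[where f = "(*)"] sum.cong vacuum_vector_Suc refl)
       (simp add: tsphere_def generic_verts)
  have "(\<lambda>N. chebyshev_shift k (\<lambda>r. ell N r (vacuum_vector k m N)) n)
      \<longlonglongrightarrow> mean (chebyshev_P k * chebyshev_P k ^ m * chebyshev_P n)"
    unfolding chebyshev_shift_mean[symmetric] by (intro tendsto_chebyshev_shift Suc)
  from tendsto_add[OF ell_avg_dist_sphere[OF h_bounded_vacuum_vector[of k m], of n k] this]
  show ?case by (simp add: eq)
qed

lemma vacuum_moments:
  "(\<lambda>N. vacuum_vector k m N []) \<longlonglongrightarrow> mean (chebyshev_P k ^ m)"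
proof -
  have "ell N 0 (vacuum_vector k m N) = vacuum_vector k m N []" for N
    by (simp add: avg_def tsphere_0 generic_Nil)
  then show ?thesis using ell_vacuum_vector[of 0 k m] by simp
qed

lemma rescale_power_eq_powr:
  "N \<ge> 1 \<Longrightarrow> rescale N ^ n = (real N * real \<sigma>) powr (- real n / 2)"
  unfolding rescale_def using \<sigma>_pos by (subst powr_minus_half) auto

theorem vacuum_moments_tendsto:
  "(\<lambda>N. (real N * real \<sigma>) powr (- (real k * real m) / 2) *
      matrix_power (verts N) (free_power_distance_matrix V E e N k) m [] [])
    \<longlonglongrightarrow> expectation (\<lambda>\<omega>. poly (chebyshev_P k) (s \<omega>) ^ m)"
proof (rule Lim_transform_eventually)
  show "(\<lambda>N. vacuum_vector k m N []) \<longlonglongrightarrow> expectation (\<lambda>\<omega>. poly (chebyshev_P k) (s \<omega>) ^ m)"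
    using vacuum_moments[of k m] by (simp add: mean_def poly_power)
  show "\<forall>\<^sub>F N in sequentially. vacuum_vector k m N [] = (real N * real \<sigma>) powr (- (real k * real m) / 2) *
      matrix_power (verts N) (free_power_distance_matrix V E e N k) m [] []"
    using eventually_ge_at_top[of 1]
    by eventually_elim (simp add: vacuum_vector_def rescale_power_eq_powr)
qed

theorem vacuum_weak_conv:
  assumes \<mu>: "\<And>N. N \<ge> 1 \<Longrightarrow> is_vacuum_distribution (verts N) []
     (\<lambda>x y. (real N * real \<sigma>) powr (- real k / 2) * free_power_distance_matrix V E e N k x y) (\<mu> N)"
  shows "weak_conv_m \<mu> (distr \<Omega> borel (\<lambda>\<omega>. poly (chebyshev_P k) (s \<omega>)))"
proof -
  let ?L = "distr \<Omega> borel (\<lambda>\<omega>. poly (chebyshev_P k) (s \<omega>))"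
  have [measurable]: "(\<lambda>\<omega>. poly (chebyshev_P k) (s \<omega>)) \<in> borel_measurable \<Omega>"
    by (intro borel_measurable_continuous_on[OF _ measurable_s] continuous_intros)
  have L_moments: "integrable ?L (\<lambda>x. x ^ m) \<and> (\<integral>x. x ^ m \<partial>?L) = mean (chebyshev_P k ^ m)" for m
    using integrable_poly[of "chebyshev_P k ^ m"]
    by (simp add: integrable_distr_eq integral_distr mean_def poly_power)
  have moments: "(\<integral>x. x ^ m \<partial>\<mu> N) = vacuum_vector k m N []" if "N \<ge> 1" for N m
    using \<mu>[OF that] unfolding vacuum_vector_def power_mult rescale_power_eq_powr[OF that, of k]
    by (simp add: is_vacuum_distribution_def matrix_power_scale)
  obtain C where C: "\<And>m. mean (chebyshev_P k ^ m) \<le> C ^ m"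
    using poly_moments_bounded[of "chebyshev_P k"] by blast
  \<comment> \<open>The hypothesis on \<open>\<mu>\<close> starts at \<open>N = 1\<close>, so the
    sequence is shifted by one and shifted back at the level of distribution functions.\<close>
  have "weak_conv_m (\<lambda>N. \<mu> (Suc N)) ?L"
  proof (rule weak_conv_m_of_moments)
    show "real_distribution (\<mu> (Suc N))" "integrable (\<mu> (Suc N)) (\<lambda>x. x ^ m)" for N m
      using \<mu>[of "Suc N"] by (auto simp: is_vacuum_distribution_def)
    show "real_distribution ?L" by (rule real_distribution_distr) simp
    show "(\<lambda>N. \<integral>x. x ^ m \<partial>\<mu> (Suc N)) \<longlonglongrightarrow> (\<integral>x. x ^ m \<partial>?L)" for m
      using LIMSEQ_Suc[OF vacuum_moments[of k m]] by (simp add: moments L_moments)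
    show "(\<integral>x. x ^ m \<partial>?L) \<le> C ^ m" for m using C by (simp add: L_moments)
  qed (simp add: L_moments)
  then show ?thesis
    unfolding weak_conv_m_def weak_conv_def
    by (auto intro: LIMSEQ_imp_Suc[where f = "\<lambda>n. cdf (\<mu> n) x" for x])
qed

end

theorem theorem1p4:
  fixes V :: "'a set" and E :: "'a set set" and e :: 'a
    and k :: nat
    and \<Omega> :: "'b measure" and s :: "'b \<Rightarrow> real"
  assumes "finite V" and "simple_graph V E" and "connected_graph V E"
    and "e \<in> V" and "card V \<ge> 2"
    and "k \<ge> 1"
    and "prob_space \<Omega>"
    and "distributed \<Omega> lborel s (\<lambda>x. ennreal (semicircle_density x))"
  shows "(\<forall>m\<ge>1. (\<lambda>N. (real N * real (degree_in E e)) powr (- (real k * real m) / 2) *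
              matrix_power (free_power_verts V e N) (free_power_distance_matrix V E e N k) m [] [])
            \<longlonglongrightarrow> prob_space.expectation \<Omega> (\<lambda>\<omega>. poly (chebyshev_P k) (s \<omega>) ^ m))
       \<and> (\<forall>\<mu> :: nat \<Rightarrow> real measure.
            (\<forall>N\<ge>1. is_vacuum_distribution (free_power_verts V e N) []
               (\<lambda>x y. (real N * real (degree_in E e)) powr (- real k / 2) *
                  free_power_distance_matrix V E e N k x y) (\<mu> N))
            \<longrightarrow> weak_conv_m \<mu> (distr \<Omega> borel (\<lambda>\<omega>. poly (chebyshev_P k) (s \<omega>))))"
proof -
  interpret rooted_graph_semicircle V E e \<Omega> s
    using assms
    by (simp add: rooted_graph_semicircle_def rooted_graph_def semicircle_variable_def
        semicircle_variable_axioms_def)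
  show ?thesis using vacuum_moments_tendsto vacuum_weak_conv by blast
qed

end
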